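(* Let $U$ be a unitary operator on $\ell^2(\mathbb{Z}_+)$ with cyclic vector $e_1$ and spectral measure $\mu$ with respect to $e_1$, and let $\alpha_0,\alpha_1,\ldots\in\mathbb{D}$ be the Verblunsky coefficients of $\mu$. Then applying the Gram--Schmidt orthonormalization procedure to $$e_1,\ [\operatorname{Im}U]e_1,\ [\operatorname{Re}U]e_1,\ [\operatorname{Im}(U^2)]e_1,\ [\operatorname{Re}(U^2)]e_1,\ \ldots$$ produces a basis $\{s_k\}$ in which $U$ has the form $$\mathcal{S}(\alpha_0,\alpha_1,\ldots):=\mathcal{N}\mathcal{L}\mathcal{N}^T,$$ where $\mathcal{L}=\mathcal{L}^T=\operatorname{diag}(\Xi_0,\Xi_2,\Xi_4,\ldots)$ with $\Xi_k=\begin{bmatrix}\bar\alpha_k&\rho_k\\\rho_k&-\alpha_k\end{bmatrix}$, $\rho_k=\sqrt{1-|\alpha_k|^2}$, and $\mathcal{N}$ is the unitary matrix $$\mathcal{N}=\operatorname{diag}([1],\Psi_1,\Psi_3,\ldots),\qquad\Psi_k=\frac1{\sqrt{2(1-\operatorname{Re}\alpha_k)}}\begin{bmatrix}i(1-\bar\alpha_k)&-i\rho_k\\\rho_k&1-\alpha_k\end{bmatrix}.$$ The matrix $\mathcal{S}$ is $7$-diagonal and symmetric, $\mathcal{S}^T=\mathcal{S}$. In fact $U=R\mathcal{S}R^\dagger$ with $R^\dagger R=RR^\dagger=I$ and $Re_1=R^\dagger e_1=e_1$. Moreover, if $U^T=U$, then $R$ is orthogonal.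
   Context: $e_1=[1,0,0,\ldots]^T$; $\mathbb{D}=\{|z|<1\}$. For an operator $T$, $\operatorname{Re}T=\frac12(T+T^\dagger)$ and $\operatorname{Im}T=\frac1{2i}(T-T^\dagger)$; $T^T$ is the (entrywise, non-conjugated) transpose. Cyclic means that the span of $\{U^me_1:m\in\mathbb{Z}\}$ is dense. The spectral measure $\mu$ is the probability measure on the unit circle with $\langle e_1,U^me_1\rangle=\int_0^{2\pi}e^{im\theta}d\mu(\theta)$ for all $m\in\mathbb{Z}$. Its Verblunsky coefficients $\alpha_k$ are defined by the recurrence $\Phi_{k+1}(z)=z\Phi_k(z)-\bar\alpha_k\Phi_k^*(z)$, where $\Phi_k$ is the monic polynomial of degree $k$ orthogonal to all polynomials of smaller degree in $L^2(\mu)$ and $\Phi_k^*(z)=z^k\overline{\Phi_k(1/\bar z)}$. Here $R$ is the matrix whose columns are the vectors $s_k$ (in the order produced by Gram--Schmidt). "$7$-diagonal" means that entries $(j,k)$ with $|j-k|>3$ vanish. "Orthogonal" means real unitary. *)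

theory Defs
  imports "HOL-Probability.Probability"
begin

section \<open>The Hilbert space of square-summable complex sequences\<close>

text \<open>Indices start at 0, so the vector $e_1$ of the mathematical text is \<open>evec 0\<close> and
  the matrix entry in row 1, column 1 is the entry \<open>(0, 0)\<close>.\<close>

lemma square_summable_add:
  fixes x y :: "nat \<Rightarrow> complex"
  assumes "summable (\<lambda>n. (cmod (x n))\<^sup>2)" "summable (\<lambda>n. (cmod (y n))\<^sup>2)"
  shows "summable (\<lambda>n. (cmod (x n + y n))\<^sup>2)"
proof (rule summable_comparison_test')
  show "summable (\<lambda>n. 2 * (cmod (x n))\<^sup>2 + 2 * (cmod (y n))\<^sup>2)"
    by (intro summable_add summable_mult assms)
  fix n :: nat
  have "(cmod (x n + y n))\<^sup>2 \<le> (cmod (x n) + cmod (y n))\<^sup>2"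
    by (intro power_mono norm_triangle_ineq) auto
  also have "\<dots> \<le> 2 * (cmod (x n))\<^sup>2 + 2 * (cmod (y n))\<^sup>2"
    using sum_squares_bound[of "cmod (x n)" "cmod (y n)"] by (simp add: power2_sum)
  finally show "norm ((cmod (x n + y n))\<^sup>2) \<le> 2 * (cmod (x n))\<^sup>2 + 2 * (cmod (y n))\<^sup>2"
    by simp
qed

lemma square_summable_scale:
  fixes x :: "nat \<Rightarrow> complex"
  assumes "summable (\<lambda>n. (cmod (x n))\<^sup>2)"
  shows "summable (\<lambda>n. (cmod (c * x n))\<^sup>2)"
  using summable_mult[OF assms, of "(cmod c)\<^sup>2"] by (simp add: norm_mult power_mult_distrib)

lemma square_summable_cinner:
  fixes x y :: "nat \<Rightarrow> complex"
  assumes "summable (\<lambda>n. (cmod (x n))\<^sup>2)" "summable (\<lambda>n. (cmod (y n))\<^sup>2)"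
  shows "summable (\<lambda>n. cnj (x n) * y n)"
proof (rule summable_norm_cancel, rule summable_comparison_test')
  show "summable (\<lambda>n. (cmod (x n))\<^sup>2 + (cmod (y n))\<^sup>2)"
    by (intro summable_add assms)
  fix n :: nat
  show "norm (norm (cnj (x n) * y n)) \<le> (cmod (x n))\<^sup>2 + (cmod (y n))\<^sup>2"
  proof -
    have "0 \<le> cmod (x n) * cmod (y n)" by simp
    then show ?thesis
      using sum_squares_bound[of "cmod (x n)" "cmod (y n)"]
      by (simp add: norm_mult del: zero_le_mult_iff mult_nonneg_nonneg)
  qed
qed

typedef ell2 = "{x :: nat \<Rightarrow> complex. summable (\<lambda>n. (cmod (x n))\<^sup>2)}"
  morphisms coord Abs_ell2
  by (rule exI[of _ "\<lambda>_. 0"]) simp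

setup_lifting type_definition_ell2

lemma summable_coord: "summable (\<lambda>n. (cmod (coord x n))\<^sup>2)"
  using coord by blast

lift_definition evec :: "nat \<Rightarrow> ell2" is "\<lambda>k n. if n = k then 1 else 0"
  by (rule summable_finite[of "{k}" for k]) auto

lift_definition scaleC :: "complex \<Rightarrow> ell2 \<Rightarrow> ell2" (infixr "*\<^sub>C" 75) is "\<lambda>c x n. c * x n"
  by (rule square_summable_scale)

definition cinner :: "ell2 \<Rightarrow> ell2 \<Rightarrow> complex" where
  "cinner x y = (\<Sum>n. cnj (coord x n) * coord y n)"

text \<open>The norm and the topology of \<open>ell2\<close> come from the underlying real inner product
  \<open>Re (cinner x y)\<close>; thus \<open>norm x = sqrt (\<Sum>n. (cmod (coord x n))\<^sup>2)\<close>.\<close>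

instantiation ell2 :: real_inner
begin

lift_definition zero_ell2 :: ell2 is "\<lambda>_. 0" by simp
lift_definition plus_ell2 :: "ell2 \<Rightarrow> ell2 \<Rightarrow> ell2" is "\<lambda>x y n. x n + y n"
  by (rule square_summable_add)
lift_definition uminus_ell2 :: "ell2 \<Rightarrow> ell2" is "\<lambda>x n. - x n" by simp
lift_definition minus_ell2 :: "ell2 \<Rightarrow> ell2 \<Rightarrow> ell2" is "\<lambda>x y n. x n - y n"
  subgoal for x y using square_summable_add[of x "\<lambda>n. - y n"] by simp
  done
lift_definition scaleR_ell2 :: "real \<Rightarrow> ell2 \<Rightarrow> ell2" is "\<lambda>r x n. complex_of_real r * x n"
  by (rule square_summable_scale)

definition inner_ell2 :: "ell2 \<Rightarrow> ell2 \<Rightarrow> real" where "inner_ell2 x y = Re (cinner x y)"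
definition norm_ell2 :: "ell2 \<Rightarrow> real" where "norm_ell2 x = sqrt (inner x x)"
definition sgn_ell2 :: "ell2 \<Rightarrow> ell2" where "sgn_ell2 x = inverse (norm x) *\<^sub>R x"
definition dist_ell2 :: "ell2 \<Rightarrow> ell2 \<Rightarrow> real" where "dist_ell2 x y = norm (x - y)"
definition uniformity_ell2 :: "(ell2 \<times> ell2) filter" where
  "uniformity_ell2 = (INF \<epsilon>\<in>{0<..}. principal {(x, y). dist x y < \<epsilon>})"
definition open_ell2 :: "ell2 set \<Rightarrow> bool" where
  "open_ell2 V = (\<forall>x\<in>V. \<forall>\<^sub>F (x', y) in uniformity. x' = x \<longrightarrow> y \<in> V)"

instance
proof
  fix x y z :: ell2 and r s :: real
  show "x + y + z = x + (y + z)" by transfer (simp add: add.assoc)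
  show "x + y = y + x" by transfer (simp add: add.commute)
  show "0 + x = x" by transfer simp
  show "- x + x = 0" by transfer simp
  show "x - y = x + - y" by transfer simp
  show "r *\<^sub>R (x + y) = r *\<^sub>R x + r *\<^sub>R y" by transfer (simp add: algebra_simps)
  show "(r + s) *\<^sub>R x = r *\<^sub>R x + s *\<^sub>R x" by transfer (simp add: algebra_simps)
  show "r *\<^sub>R s *\<^sub>R x = (r * s) *\<^sub>R x" by transfer (simp add: algebra_simps)
  show "1 *\<^sub>R x = x" by transfer simp
  show "sgn x = inverse (norm x) *\<^sub>R x" by (simp add: sgn_ell2_def)
  show "dist x y = norm (x - y)" by (simp add: dist_ell2_def)
  show "uniformity = (INF \<epsilon>\<in>{0<..}. principal {(x::ell2, y). dist x y < \<epsilon>})"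
    by (simp add: uniformity_ell2_def)
  show "open V = (\<forall>x\<in>V. \<forall>\<^sub>F (x', y) in uniformity. x' = x \<longrightarrow> y \<in> V)" for V :: "ell2 set"
    by (simp add: open_ell2_def)
  show "norm x = sqrt (inner x x)" by (simp add: norm_ell2_def)
  have re: "inner x y = (\<Sum>n. Re (cnj (coord x n) * coord y n))"
    and sm: "summable (\<lambda>n. Re (cnj (coord x n) * coord y n))" for x y
    using Re_suminf[OF square_summable_cinner[OF summable_coord summable_coord], of x y]
      summable_Re[OF square_summable_cinner[OF summable_coord summable_coord], of x y]
    by (simp_all add: inner_ell2_def cinner_def)
  show "inner x y = inner y x"
    unfolding re by (simp add: mult.commute)
  show "inner (x + y) z = inner x z + inner y z"
    unfolding re suminf_add[OF sm sm] by (simp add: plus_ell2.rep_eq algebra_simps)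
  show "inner (r *\<^sub>R x) y = r * inner x y"
    unfolding re suminf_mult[OF sm, symmetric] by (simp add: scaleR_ell2.rep_eq algebra_simps)
  have sq: "Re (cnj (coord x n) * coord x n) = (cmod (coord x n))\<^sup>2" for n
    by (simp only: cmod_power2) (simp add: power2_eq_square)
  show "0 \<le> inner x x"
    unfolding re sq by (intro suminf_nonneg summable_coord) simp
  show "inner x x = 0 \<longleftrightarrow> x = 0"
    unfolding re sq using suminf_eq_zero_iff[OF summable_coord, of x]
    by (simp add: coord_inject[symmetric] zero_ell2.rep_eq fun_eq_iff)
qed

end

lemma vector_space_scaleC: "vector_space scaleC"
  by standard (transfer, simp add: algebra_simps)+

definition cspan :: "ell2 set \<Rightarrow> ell2 set" where
  "cspan = module.span scaleC"

definition orthonormal_basis :: "(nat \<Rightarrow> ell2) \<Rightarrow> bool" where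
  "orthonormal_basis s \<longleftrightarrow>
     (\<forall>j k. cinner (s j) (s k) = (if j = k then 1 else 0)) \<and> closure (cspan (range s)) = UNIV"


section \<open>Operators\<close>

definition bounded_clinear :: "(ell2 \<Rightarrow> ell2) \<Rightarrow> bool" where
  "bounded_clinear T \<longleftrightarrow> Vector_Spaces.linear scaleC scaleC T \<and> bounded_linear T"

definition unitary_op :: "(ell2 \<Rightarrow> ell2) \<Rightarrow> bool" where
  "unitary_op T \<longleftrightarrow> Vector_Spaces.linear scaleC scaleC T \<and>
     (\<forall>x y. cinner (T x) (T y) = cinner x y) \<and> surj T"

definition adj :: "(ell2 \<Rightarrow> ell2) \<Rightarrow> ell2 \<Rightarrow> ell2" where
  "adj T = (THE T'. \<forall>x y. cinner (T x) y = cinner x (T' y))"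

definition Re_op :: "(ell2 \<Rightarrow> ell2) \<Rightarrow> ell2 \<Rightarrow> ell2" where
  "Re_op T x = (1 / 2) *\<^sub>C (T x + adj T x)"

definition Im_op :: "(ell2 \<Rightarrow> ell2) \<Rightarrow> ell2 \<Rightarrow> ell2" where
  "Im_op T x = (1 / (2 * \<i>)) *\<^sub>C (T x - adj T x)"

text \<open>Integer powers of an invertible operator.\<close>

definition op_powi :: "(ell2 \<Rightarrow> ell2) \<Rightarrow> int \<Rightarrow> ell2 \<Rightarrow> ell2" where
  "op_powi U m = (if 0 \<le> m then U ^^ nat m else inv U ^^ nat (- m))"

definition cyclic_vector :: "(ell2 \<Rightarrow> ell2) \<Rightarrow> ell2 \<Rightarrow> bool" where
  "cyclic_vector U v \<longleftrightarrow> closure (cspan (range (\<lambda>m. op_powi U m v))) = UNIV"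


section \<open>Infinite matrices\<close>

type_synonym cmatrix = "nat \<Rightarrow> nat \<Rightarrow> complex"

text \<open>The matrix of an operator in the standard basis; it determines a bounded operator.\<close>

definition op_matrix :: "(ell2 \<Rightarrow> ell2) \<Rightarrow> cmatrix" where
  "op_matrix T = (\<lambda>j k. cinner (evec j) (T (evec k)))"

definition mat_mult :: "cmatrix \<Rightarrow> cmatrix \<Rightarrow> cmatrix" (infixl "\<odot>" 70) where
  "A \<odot> B = (\<lambda>i j. \<Sum>k. A i k * B k j)"

definition mat_transpose :: "cmatrix \<Rightarrow> cmatrix" where
  "mat_transpose A = (\<lambda>i j. A j i)"

definition mat_dagger :: "cmatrix \<Rightarrow> cmatrix" where
  "mat_dagger A = (\<lambda>i j. cnj (A j i))"

definition mat_id :: cmatrix where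
  "mat_id = (\<lambda>i j. if i = j then 1 else 0)"

definition unitary_matrix :: "cmatrix \<Rightarrow> bool" where
  "unitary_matrix A \<longleftrightarrow> mat_dagger A \<odot> A = mat_id \<and> A \<odot> mat_dagger A = mat_id"

definition orthogonal_op :: "(ell2 \<Rightarrow> ell2) \<Rightarrow> bool" where
  "orthogonal_op T \<longleftrightarrow> unitary_op T \<and> (\<forall>j k. op_matrix T j k \<in> \<real>)"

text \<open>\<open>mat2 a b c d\<close> is the 2-by-2 block with rows \<open>(a, b)\<close> and \<open>(c, d)\<close>;
  \<open>diag2 B\<close> is the block diagonal matrix diag(\<open>B 0\<close>, \<open>B 1\<close>, ...) with 2-by-2 blocks, and
  \<open>diag12 B\<close> is diag([1], \<open>B 0\<close>, \<open>B 1\<close>, ...).\<close>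

definition mat2 :: "complex \<Rightarrow> complex \<Rightarrow> complex \<Rightarrow> complex \<Rightarrow> cmatrix" where
  "mat2 a b c d = (\<lambda>i j. [[a, b], [c, d]] ! i ! j)"

definition diag2 :: "(nat \<Rightarrow> cmatrix) \<Rightarrow> cmatrix" where
  "diag2 B = (\<lambda>i j. if i div 2 = j div 2 then B (i div 2) (i mod 2) (j mod 2) else 0)"

fun diag12 :: "(nat \<Rightarrow> cmatrix) \<Rightarrow> cmatrix" where
  "diag12 B 0 0 = 1"
| "diag12 B 0 (Suc j) = 0"
| "diag12 B (Suc i) 0 = 0"
| "diag12 B (Suc i) (Suc j) = diag2 B i j"


section \<open>Spectral measure and Verblunsky coefficients\<close>

text \<open>The point \<open>exp (\<i> * \<theta>)\<close> is the integration variable, rather than the angle.\<close>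

definition spectral_measure :: "(ell2 \<Rightarrow> ell2) \<Rightarrow> ell2 \<Rightarrow> complex measure \<Rightarrow> bool" where
  "spectral_measure U v \<mu> \<longleftrightarrow>
     prob_space \<mu> \<and> space \<mu> = sphere 0 1 \<and> sets \<mu> = sets (restrict_space borel (sphere 0 1)) \<and>
     (\<forall>m::int. cinner v (op_powi U m v) = (\<integral>z. z powi m \<partial>\<mu>))"

definition monic_orthogonal_poly :: "complex measure \<Rightarrow> nat \<Rightarrow> complex poly \<Rightarrow> bool" where
  "monic_orthogonal_poly \<mu> k p \<longleftrightarrow> degree p = k \<and> lead_coeff p = 1 \<and>
     (\<forall>q. degree q < k \<longrightarrow> (\<integral>z. cnj (poly q z) * poly p z \<partial>\<mu>) = 0)"

definition dual_poly :: "nat \<Rightarrow> complex poly \<Rightarrow> complex \<Rightarrow> complex" where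
  "dual_poly k p z = z ^ k * cnj (poly p (1 / cnj z))"

text \<open>The defining formula of the dual polynomial is meaningful at nonzero points only. An
  identity of polynomials that holds at all nonzero points holds everywhere.\<close>

definition verblunsky_coeffs :: "complex measure \<Rightarrow> (nat \<Rightarrow> complex) \<Rightarrow> bool" where
  "verblunsky_coeffs \<mu> \<alpha> \<longleftrightarrow>
     (\<exists>\<Phi>. (\<forall>k. monic_orthogonal_poly \<mu> k (\<Phi> k)) \<and>
        (\<forall>k z. z \<noteq> 0 \<longrightarrow>
           poly (\<Phi> (Suc k)) z = z * poly (\<Phi> k) z - cnj (\<alpha> k) * dual_poly k (\<Phi> k) z))"


section \<open>The Gram--Schmidt basis\<close>

text \<open>A vector that depends linearly on its predecessors would be sent to 0.\<close>

function gram_schmidt :: "(nat \<Rightarrow> ell2) \<Rightarrow> nat \<Rightarrow> ell2" where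
  "gram_schmidt v k =
     (let w = v k - (\<Sum>j<k. cinner (gram_schmidt v j) (v k) *\<^sub>C gram_schmidt v j)
      in w /\<^sub>R norm w)"
  by auto
termination
  by (relation "Wellfounded.measure snd") auto

declare gram_schmidt.simps [simp del]

text \<open>The sequence $e_1$, Im($U$)$e_1$, Re($U$)$e_1$, Im($U^2$)$e_1$, Re($U^2$)$e_1$, \<dots>\<close>

definition re_im_sequence :: "(ell2 \<Rightarrow> ell2) \<Rightarrow> nat \<Rightarrow> ell2" where
  "re_im_sequence U n =
     (if n = 0 then evec 0
      else if odd n then Im_op (U ^^ ((n + 1) div 2)) (evec 0)
      else Re_op (U ^^ (n div 2)) (evec 0))"

definition gs_basis :: "(ell2 \<Rightarrow> ell2) \<Rightarrow> nat \<Rightarrow> ell2" where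
  "gs_basis U = gram_schmidt (re_im_sequence U)"


section \<open>The matrices L, N and S\<close>

definition rho :: "complex \<Rightarrow> complex" where
  "rho a = complex_of_real (sqrt (1 - (cmod a)\<^sup>2))"

definition Xi :: "complex \<Rightarrow> cmatrix" where
  "Xi a = mat2 (cnj a) (rho a) (rho a) (- a)"

definition Psi :: "complex \<Rightarrow> cmatrix" where
  "Psi a = (\<lambda>i j. complex_of_real (1 / sqrt (2 * (1 - Re a))) *
     mat2 (\<i> * (1 - cnj a)) (- \<i> * rho a) (rho a) (1 - a) i j)"

definition Lmat :: "(nat \<Rightarrow> complex) \<Rightarrow> cmatrix" where
  "Lmat \<alpha> = diag2 (\<lambda>m. Xi (\<alpha> (2 * m)))"

definition Nmat :: "(nat \<Rightarrow> complex) \<Rightarrow> cmatrix" where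
  "Nmat \<alpha> = diag12 (\<lambda>m. Psi (\<alpha> (2 * m + 1)))"

definition Smat :: "(nat \<Rightarrow> complex) \<Rightarrow> cmatrix" where
  "Smat \<alpha> = Nmat \<alpha> \<odot> Lmat \<alpha> \<odot> mat_transpose (Nmat \<alpha>)"

end

theory Submission
  imports Defs
begin

text \<open>
  The cyclic vector \<open>e\<close> turns functions \<open>f\<close> on the unit circle into vectors \<open>f(U) e\<close>, and \<open>U\<close> into
  multiplication by \<open>z\<close>. In this picture the vectors \<open>Im (U\<^sup>k) e\<close> and \<open>Re (U\<^sup>k) e\<close> are real trigonometric
  functions, so the Gram--Schmidt vectors \<open>s\<^sub>k\<close> are real functions, and the matrix
  \<open>\<integral> s\<^sub>j z s\<^sub>k d\<mu>\<close> of \<open>U\<close> in them is symmetric.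

  The factorization comes from the CMV basis \<open>\<chi>\<close>, which consists of shifts of the orthonormal polynomials
  \<open>\<phi>\<^sub>k\<close> and of their duals \<open>\<phi>\<^sub>k\<^sup>*\<close>, and from the alternate basis \<open>x\<close>, whose elements are the complex
  conjugates of those of \<open>\<chi>\<close>. The Szego recursion says that multiplication by \<open>z\<close> takes \<open>x\<close> to \<open>\<chi>\<close>
  through the block diagonal matrix \<open>L\<close> (\<open>U_chi_alt\<close>), and that neighbours \<open>\<chi>\<^sub>2\<^sub>m\<^sub>-\<^sub>1\<close>, \<open>\<chi>\<^sub>2\<^sub>m\<close> span the same
  plane as their conjugates. In this plane the functions \<open>Im \<chi>\<^sub>2\<^sub>m\<^sub>-\<^sub>1\<close> and \<open>Re ((1 - \<alpha>\<^sub>2\<^sub>m\<^sub>-\<^sub>1) \<chi>\<^sub>2\<^sub>m\<^sub>-\<^sub>1)\<close>, suitably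
  scaled, form an orthonormal basis, whose coefficients in \<open>x\<close> are the rows of \<open>\<Psi>\<^sub>2\<^sub>m\<^sub>-\<^sub>1\<close> (\<open>real_basis_pair\<close>). Their
  leading coefficients with respect to \<open>Im z\<^sup>m\<close> and \<open>Re z\<^sup>m\<close> are positive (\<open>real_basis_leading\<close>), so by
  uniqueness of the Gram--Schmidt procedure (\<open>gram_schmidt_unique\<close>) they are the \<open>s\<^sub>k\<close>. Expanding one
  argument of \<open>\<integral> s\<^sub>j z s\<^sub>k d\<mu>\<close> in \<open>\<chi>\<close> and the other one in \<open>x\<close> gives \<open>N L N\<^sup>T\<close> (\<open>real_basis_matrix\<close>).

  In the sequence space, \<open>\<phi>\<^sub>k(U) e\<close> and \<open>\<phi>\<^sub>k\<^sup>*(U) e\<close> are defined by the recursion. Comparing moments transfers the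
  orthogonality of the polynomials to them (\<open>szego_orthogonal\<close>), and the rest is linear algebra with the
  orbit of \<open>e\<close>. The unitary \<open>R\<close> is the adjoint of the
  coefficient map of the basis (\<open>orthonormal_basis_isomorphism\<close>). If the matrix of \<open>U\<close> is symmetric, the
  complex conjugation of coordinates fixes \<open>Re (U\<^sup>k) e\<close> and \<open>Im (U\<^sup>k) e\<close>, hence every \<open>s\<^sub>k\<close>, so that the
  matrix of \<open>R\<close> is real.
\<close>

section \<open>The geometry of the sequence space\<close>

interpretation ell2: vector_space scaleC
  by (rule vector_space_scaleC)

lemma coord_simps [simp]:
  "coord 0 n = 0" "coord (x + y) n = coord x n + coord y n"
  "coord (x - y) n = coord x n - coord y n" "coord (- x) n = - coord x n"
  "coord (c *\<^sub>C x) n = c * coord x n"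
  "coord (evec k) n = (if n = k then 1 else 0)"
  by (transfer; simp)+

lemma coord_sum [simp]: "coord (\<Sum>i\<in>F. f i) n = (\<Sum>i\<in>F. coord (f i) n)"
  by (induction F rule: infinite_finite_induct) auto

lemma ell2_eqI: "(\<And>n. coord x n = coord y n) \<Longrightarrow> x = y"
  by (simp add: coord_inject[symmetric] fun_eq_iff)

lemma scaleR_eq_scaleC: "r *\<^sub>R x = complex_of_real r *\<^sub>C (x :: ell2)"
  by transfer simp

lemma summable_cinner: "summable (\<lambda>n. cnj (coord x n) * coord y n)"
  by (intro square_summable_cinner summable_coord)

lemma cinner_add_right: "cinner x (y + z) = cinner x y + cinner x z"
  by (simp add: cinner_def distrib_left distrib_right suminf_add[OF summable_cinner summable_cinner])

lemma cinner_add_left: "cinner (x + y) z = cinner x z + cinner y z"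
  by (simp add: cinner_def distrib_left distrib_right suminf_add[OF summable_cinner summable_cinner])

lemma cinner_scaleC_right: "cinner x (c *\<^sub>C y) = c * cinner x y"
  using suminf_mult[OF summable_cinner, of c x y] by (simp add: cinner_def algebra_simps)

lemma cinner_scaleC_left: "cinner (c *\<^sub>C x) y = cnj c * cinner x y"
  using suminf_mult[OF summable_cinner, of "cnj c" x y] by (simp add: cinner_def algebra_simps)

lemma cinner_commute: "cinner x y = cnj (cinner y x)"
  unfolding cinner_def
  by (subst bounded_linear.suminf[OF bounded_linear_cnj summable_cinner]) (simp add: mult.commute)

lemma cinner_zero [simp]: "cinner x 0 = 0" "cinner 0 x = 0"
  by (simp_all add: cinner_def)

lemma cinner_minus: "cinner x (- y) = - cinner x y" "cinner (- x) y = - cinner x y"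
  using cinner_add_right[of x y "- y"] cinner_add_left[of x "- x" y]
  by (simp_all add: add_eq_0_iff2 add_eq_0_iff)

lemma cinner_diff_right: "cinner x (y - z) = cinner x y - cinner x z"
  using cinner_add_right[of x y "- z"] by (simp add: cinner_minus)

lemma cinner_diff_left: "cinner (x - y) z = cinner x z - cinner y z"
  using cinner_add_left[of x "- y" z] by (simp add: cinner_minus)

lemma cinner_sum_right: "cinner x (\<Sum>i\<in>F. f i) = (\<Sum>i\<in>F. cinner x (f i))"
  by (induction F rule: infinite_finite_induct) (auto simp: cinner_add_right)

lemma cinner_sum_left: "cinner (\<Sum>i\<in>F. f i) x = (\<Sum>i\<in>F. cinner (f i) x)"
  by (induction F rule: infinite_finite_induct) (auto simp: cinner_add_left)

lemmas cinner_simps = cinner_add_right cinner_add_left cinner_diff_right cinner_diff_left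
  cinner_scaleC_right cinner_scaleC_left cinner_sum_right cinner_sum_left

lemma cinner_evec [simp]: "cinner (evec k) x = coord x k" "cinner x (evec k) = cnj (coord x k)"
proof -
  have "cinner (evec k) x = (\<Sum>n\<in>{k}. cnj (coord (evec k) n) * coord x n)"
    unfolding cinner_def by (rule suminf_finite) auto
  then show "cinner (evec k) x = coord x k" by simp
  then show "cinner x (evec k) = cnj (coord x k)" by (subst cinner_commute) simp
qed

lemma norm_sums: "(\<lambda>n. (cmod (coord x n))\<^sup>2) sums (norm x)\<^sup>2"
proof -
  have "(\<lambda>n. Re (cnj (coord x n) * coord x n)) sums Re (cinner x x)"
    unfolding cinner_def by (intro sums_Re summable_sums summable_cinner)
  also have "Re (cinner x x) = (norm x)\<^sup>2"
    by (simp add: norm_ell2_def inner_ell2_def[symmetric])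
  also have "(\<lambda>n. Re (cnj (coord x n) * coord x n)) = (\<lambda>n. (cmod (coord x n))\<^sup>2)"
    by (simp add: fun_eq_iff cmod_power2) (simp add: power2_eq_square)
  finally show ?thesis .
qed

lemma cinner_self: "cinner x x = complex_of_real ((norm x)\<^sup>2)"
proof (rule complex_eqI)
  show "Re (cinner x x) = Re (complex_of_real ((norm x)\<^sup>2))"
    by (simp add: norm_ell2_def inner_ell2_def[symmetric])
  show "Im (cinner x x) = Im (complex_of_real ((norm x)\<^sup>2))"
    using arg_cong[OF cinner_commute[of x x], of Im] by simp
qed

lemma norm_scaleC: "norm (c *\<^sub>C x) = cmod c * norm (x :: ell2)"
proof -
  have "complex_of_real ((norm (c *\<^sub>C x))\<^sup>2) = complex_of_real ((cmod c * norm x)\<^sup>2)"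
    unfolding cinner_self[symmetric] power_mult_distrib of_real_mult
    by (simp add: cinner_simps complex_norm_square[symmetric] mult.assoc[symmetric] mult.commute)
  then have "(norm (c *\<^sub>C x))\<^sup>2 = (cmod c * norm x)\<^sup>2"
    by (simp only: of_real_eq_iff)
  then show ?thesis by (simp add: power2_eq_iff_nonneg)
qed

text \<open>The complex estimate follows from the real one: multiplying by a phase makes the inner
  product real.\<close>

lemma cinner_Cauchy_Schwarz: "cmod (cinner x y) \<le> norm x * norm y"
proof (cases "cinner x y = 0")
  case False
  define c where "c = cnj (sgn (cinner x y))"
  have "cmod c = 1" using False by (simp add: c_def norm_sgn)
  have "cinner x (c *\<^sub>C y) = complex_of_real (cmod (cinner x y))"
    using False
    by (simp add: cinner_simps c_def sgn_div_norm scaleR_conv_of_real divide_simps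
        complex_norm_square[symmetric] mult.commute power2_eq_square)
  then have "cmod (cinner x y) = inner x (c *\<^sub>C y)" by (simp add: inner_ell2_def)
  also have "\<dots> \<le> norm x * norm (c *\<^sub>C y)" by (rule norm_cauchy_schwarz)
  finally show ?thesis by (simp add: norm_scaleC \<open>cmod c = 1\<close>)
qed simp

lemma ell2_eqI_cinner: "(\<And>z. cinner x z = cinner y z) \<Longrightarrow> x = y"
proof (rule ell2_eqI)
  fix n
  assume "\<And>z. cinner x z = cinner y z"
  from arg_cong[OF this[of "evec n"], of cnj] show "coord x n = coord y n" by simp
qed

lemma clinearI:
  assumes "\<And>x y. T (x + y) = T x + T y" "\<And>c x. T (c *\<^sub>C x) = c *\<^sub>C T x"
  shows "Vector_Spaces.linear scaleC scaleC T"
  by (simp add: Vector_Spaces.linear_iff vector_space_scaleC assms)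

lemma
  assumes "Vector_Spaces.linear scaleC scaleC T"
  shows clinear_add: "T (x + y) = T x + T y" and clinear_scaleC: "T (c *\<^sub>C x) = c *\<^sub>C T x"
    and clinear_zero: "T 0 = 0" and clinear_diff: "T (x - y) = T x - T y"
    and clinear_sum: "T (\<Sum>i\<in>F. f i) = (\<Sum>i\<in>F. T (f i))"
proof -
  interpret T: Vector_Spaces.linear scaleC scaleC T by fact
  show "T (x + y) = T x + T y" "T (c *\<^sub>C x) = c *\<^sub>C T x" "T 0 = 0" "T (x - y) = T x - T y"
    "T (\<Sum>i\<in>F. f i) = (\<Sum>i\<in>F. T (f i))"
    by (rule T.add T.scale T.zero T.diff T.sum)+
qed

lemma bounded_clinearI:
  assumes "\<And>x y. T (x + y) = T x + T y" "\<And>c x. T (c *\<^sub>C x) = c *\<^sub>C T x"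
    and "\<And>x. norm (T x) \<le> norm x"
  shows "bounded_clinear T"
  unfolding bounded_clinear_def
proof
  show "bounded_linear T"
    by (rule bounded_linear_intro[where K = 1]) (auto simp: scaleR_eq_scaleC assms)
qed (intro clinearI assms)

lemma bounded_clinear_compose:
  "bounded_clinear S \<Longrightarrow> bounded_clinear T \<Longrightarrow> bounded_clinear (S \<circ> T)"
  unfolding bounded_clinear_def
  by (auto intro!: clinearI simp: clinear_add clinear_scaleC comp_def bounded_linear_compose)

lemma bounded_clinear_continuous: "bounded_clinear T \<Longrightarrow> continuous_on A T"
  by (auto simp: bounded_clinear_def intro: linear_continuous_on)

text \<open>Identities between continuous maps are closed conditions, so they extend from a set to the
  closure of its span.\<close>

lemma dense_span_induct:
  assumes "closure (cspan B) = UNIV" "closed {x. P x}" "\<And>x. x \<in> B \<Longrightarrow> P x" "P 0"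
    "\<And>x y c. P x \<Longrightarrow> P y \<Longrightarrow> P (c *\<^sub>C x + y)"
  shows "P x"
proof -
  have "P x" if "x \<in> cspan B" for x
    using that unfolding cspan_def
    by (induction rule: ell2.span_induct_alt) (auto intro: assms)
  then have "closure (cspan B) \<subseteq> {x. P x}"
    by (intro closure_minimal assms(2)) auto
  then show ?thesis using assms(1) by auto
qed

lemma continuous_on_cinner [continuous_intros]:
  assumes "continuous_on A f" "continuous_on A g"
  shows "continuous_on A (\<lambda>x. cinner (f x) (g x))"
proof -
  have 1: "cinner x y = complex_of_real (inner x y) + \<i> * complex_of_real (- inner x (\<i> *\<^sub>C y))"
    for x y by (rule complex_eqI) (auto simp: inner_ell2_def cinner_simps)
  have 2: "bounded_linear (\<lambda>x. \<i> *\<^sub>C x)"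
    by (rule bounded_linear_intro[where K = 1])
       (auto simp: scaleR_eq_scaleC norm_scaleC ell2.scale_right_distrib mult.commute)
  show ?thesis
    by (subst 1) (intro continuous_intros assms bounded_linear.continuous_on[OF 2])
qed

lemma evec_dense: "closure (cspan (range evec)) = UNIV"
proof -
  have "x \<in> closure (cspan (range evec))" for x
  proof -
    define t where "t n = (\<Sum>k<n. coord x k *\<^sub>C evec k)" for n
    have coord_t: "coord (t n) k = (if k < n then coord x k else 0)" for n k
      by (simp add: t_def if_distrib[of "\<lambda>z. _ * z"] cong: if_cong)
    have eq: "(norm (t n - x))\<^sup>2 = (norm x)\<^sup>2 - (\<Sum>k<n. (cmod (coord x k))\<^sup>2)" for n
    proof -
      have "(\<lambda>k. (cmod (coord (t n - x) k))\<^sup>2 + (if k \<in> {..<n} then (cmod (coord x k))\<^sup>2 else 0))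
          sums ((norm (t n - x))\<^sup>2 + (\<Sum>k<n. (cmod (coord x k))\<^sup>2))"
        by (intro sums_add norm_sums sums_If_finite_set) auto
      also have "(\<lambda>k. (cmod (coord (t n - x) k))\<^sup>2 + (if k \<in> {..<n} then (cmod (coord x k))\<^sup>2 else 0))
          = (\<lambda>k. (cmod (coord x k))\<^sup>2)"
        by (auto simp: fun_eq_iff coord_t)
      finally show ?thesis using sums_unique2[OF norm_sums] by fastforce
    qed
    have "(\<lambda>n. (norm x)\<^sup>2 - (\<Sum>k<n. (cmod (coord x k))\<^sup>2)) \<longlonglongrightarrow> (norm x)\<^sup>2 - (norm x)\<^sup>2"
      by (intro tendsto_intros norm_sums[unfolded sums_def])
    then have "(\<lambda>n. sqrt ((norm (t n - x))\<^sup>2)) \<longlonglongrightarrow> sqrt 0"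
      unfolding eq by (intro tendsto_real_sqrt) simp
    then have "t \<longlonglongrightarrow> x"
      by (subst LIM_zero_iff[symmetric]) (simp add: tendsto_norm_zero_iff)
    moreover have "t n \<in> cspan (range evec)" for n
      unfolding t_def cspan_def by (intro ell2.span_sum ell2.span_scale ell2.span_base) auto
    ultimately show ?thesis by (auto simp: closure_sequential)
  qed
  then show ?thesis by auto
qed

lemma adj_eqI:
  assumes "\<And>x y. cinner (T x) y = cinner x (T' y)"
  shows "adj T = T'"
  unfolding adj_def
proof (rule the_equality)
  fix T'' assume "\<forall>x y. cinner (T x) y = cinner x (T'' y)"
  then have "cinner (evec n) (T'' y) = cinner (evec n) (T' y)" for n y
    using assms by metis
  then show "T'' = T'" by (auto intro!: ell2_eqI simp: fun_eq_iff)
qed (use assms in blast)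

lemma norm_sum_orthonormal:
  fixes s :: "nat \<Rightarrow> ell2"
  assumes "\<And>j k. cinner (s j) (s k) = (if j = k then 1 else 0)"
  shows "(norm (\<Sum>k<n. c k *\<^sub>C s k))\<^sup>2 = (\<Sum>k<n. (cmod (c k))\<^sup>2)"
proof -
  define t where "t = (\<Sum>k<n. c k *\<^sub>C s k)"
  have "cinner (s k) t = (if k < n then c k else 0)" for k
    by (simp add: t_def cinner_simps assms if_distrib[of "\<lambda>z. _ * z"] cong: if_cong)
  then have "cinner t t = complex_of_real (\<Sum>k<n. (cmod (c k))\<^sup>2)"
    by (subst t_def) (simp add: cinner_simps mult.commute complex_norm_square del: of_real_power)
  then show ?thesis unfolding cinner_self of_real_eq_iff t_def .
qed

text \<open>The only point is that the coefficients are square-summable. The first \<open>n\<close> numbers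
  \<open>c k = cinner (f k) x\<close> satisfy \<open>(\<Sum>k<n. \<bar>c k\<bar>\<^sup>2) = cinner (\<Sum>k<n. c k *\<^sub>C f k) x\<close>. By the
  Cauchy--Schwarz inequality and the hypothesis, the right-hand side is at most
  \<open>sqrt (\<Sum>k<n. \<bar>c k\<bar>\<^sup>2) * norm x\<close>. Hence \<open>c\<close> is square-summable, with norm at most
  \<open>norm x\<close>.\<close>

lemma coefficient_operator:
  assumes contr: "\<And>c n. norm (\<Sum>k<n. c k *\<^sub>C f k) \<le> norm (\<Sum>k<n. c k *\<^sub>C evec k)"
  obtains T where "bounded_clinear T" "\<And>x. norm (T x) \<le> norm x"
    "\<And>x k. coord (T x) k = cinner (f k) x"
proof -
  have bound: "(\<Sum>k<n. (cmod (cinner (f k) x))\<^sup>2) \<le> (norm x)\<^sup>2" for x n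
  proof -
    define y where "y = (\<Sum>k<n. cinner (f k) x *\<^sub>C evec k)"
    define t where "t = (\<Sum>k<n. cinner (f k) x *\<^sub>C f k)"
    have sum_eq: "cinner t x = complex_of_real (\<Sum>k<n. (cmod (cinner (f k) x))\<^sup>2)"
      by (simp add: t_def cinner_simps mult.commute complex_norm_square del: of_real_power)
    have norm_y: "(norm y)\<^sup>2 = (\<Sum>k<n. (cmod (cinner (f k) x))\<^sup>2)"
      unfolding y_def by (rule norm_sum_orthonormal) simp
    have "(norm y)\<^sup>2 = cmod (cinner t x)"
      by (simp add: sum_eq norm_y sum_nonneg del: of_real_sum)
    also have "\<dots> \<le> norm t * norm x" by (rule cinner_Cauchy_Schwarz)
    also have "\<dots> \<le> norm y * norm x"
      unfolding y_def t_def by (intro mult_right_mono contr) simp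
    finally have "norm y \<le> norm x"
      by (cases "norm y = 0") (auto simp: power2_eq_square)
    then have "(norm y)\<^sup>2 \<le> (norm x)\<^sup>2" by (intro power_mono) auto
    then show ?thesis by (simp add: norm_y)
  qed
  define T where "T x = Abs_ell2 (\<lambda>k. cinner (f k) x)" for x
  have summable: "summable (\<lambda>k. (cmod (cinner (f k) x))\<^sup>2)" for x
    by (rule summableI_nonneg_bounded[OF _ bound]) simp
  have coord_T: "coord (T x) k = cinner (f k) x" for x k
    unfolding T_def by (subst Abs_ell2_inverse) (auto intro: summable)
  have contr_T: "norm (T x) \<le> norm x" for x
  proof -
    have "(norm (T x))\<^sup>2 = (\<Sum>k. (cmod (cinner (f k) x))\<^sup>2)"
      using norm_sums[of "T x"] by (simp add: sums_iff coord_T)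
    also have "\<dots> \<le> (norm x)\<^sup>2" by (intro suminf_le_const summable bound)
    finally show ?thesis by (simp add: power2_le_iff_abs_le)
  qed
  have "bounded_clinear T"
    by (intro bounded_clinearI ell2_eqI contr_T) (simp_all add: coord_T cinner_simps)
  then show thesis using that contr_T coord_T by blast
qed

text \<open>The \<open>j\<close>-th coordinate of the adjoint at \<open>x\<close> has to be \<open>cinner (T (evec j)) x\<close>.\<close>

lemma contraction_adjoint:
  assumes T: "bounded_clinear T" and contr: "\<And>x. norm (T x) \<le> norm x"
  shows "bounded_clinear (adj T)" and "cinner (T x) y = cinner x (adj T y)"
proof -
  have lin: "Vector_Spaces.linear scaleC scaleC T"
    using T by (simp add: bounded_clinear_def)
  note lin_simps = clinear_add[OF lin] clinear_scaleC[OF lin] clinear_sum[OF lin] clinear_zero[OF lin]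
  have "norm (\<Sum>k<n. c k *\<^sub>C T (evec k)) \<le> norm (\<Sum>k<n. c k *\<^sub>C evec k)" for c and n :: nat
    using contr[of "\<Sum>k<n. c k *\<^sub>C evec k"] by (simp add: lin_simps)
  then obtain T' where bl: "bounded_clinear T'"
    and coord_T': "\<And>y k. coord (T' y) k = cinner (T (evec k)) y"
    using coefficient_operator by metis
  have adj: "cinner (T x) y = cinner x (T' y)" for x y
  proof (rule dense_span_induct[OF evec_dense, of "\<lambda>x. cinner (T x) y = cinner x (T' y)"])
    show "closed {x. cinner (T x) y = cinner x (T' y)}"
      by (intro closed_Collect_eq continuous_intros bounded_clinear_continuous T)
  qed (auto simp: coord_T' lin_simps cinner_simps)
  then have "adj T = T'" by (rule adj_eqI)
  with bl adj show "bounded_clinear (adj T)" "cinner (T x) y = cinner x (adj T y)" by auto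
qed

section \<open>Unitary operators and their integer powers\<close>

locale unitary_operator =
  fixes U :: "ell2 \<Rightarrow> ell2"
  assumes unitary: "unitary_op U"
begin

lemma linear_U: "Vector_Spaces.linear scaleC scaleC U"
  and cinner_U: "cinner (U x) (U y) = cinner x y"
  and surj_U: "surj U"
  using unitary by (auto simp: unitary_op_def)

lemma inj_U: "inj U"
proof (rule injI)
  fix x y assume "U x = U y"
  then have "cinner (x - y) (x - y) = cinner (U (x - y)) 0"
    using clinear_diff[OF linear_U] cinner_U by (metis cinner_zero(1) diff_self)
  then show "x = y" by (simp add: cinner_self)
qed

lemma U_inv [simp]: "U (inv U x) = x" "inv U (U x) = x"
  using surj_U inj_U by (auto intro: surj_f_inv_f)

lemma cinner_U_left: "cinner (U x) y = cinner x (inv U y)"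
  using cinner_U[of x "inv U y"] by simp

definition orbit :: "int \<Rightarrow> ell2" where
  "orbit m = op_powi U m (evec 0)"

lemma op_powi_0 [simp]: "op_powi U 0 x = x"
  by (simp add: op_powi_def)

lemma op_powi_Suc: "op_powi U (m + 1) x = U (op_powi U m x)"
proof (cases "0 \<le> m")
  case True
  then have "nat (m + 1) = Suc (nat m)" by simp
  with True show ?thesis by (simp add: op_powi_def)
next
  case False
  then have "nat (- m) = Suc (nat (- (m + 1)))" by simp
  with False show ?thesis by (cases "m = -1") (auto simp: op_powi_def)
qed

lemma op_powi_add: "op_powi U (m + n) x = op_powi U m (op_powi U n x)"
proof (induction m rule: int_induct[where k = 0])
  case (step1 i)
  have "op_powi U (i + 1 + n) x = U (op_powi U (i + n) x)"
    using op_powi_Suc[of "i + n" x] by (simp add: algebra_simps)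
  with step1 show ?case by (simp only: op_powi_Suc)
next
  case (step2 i)
  then have "U (op_powi U (i - 1 + n) x) = U (op_powi U (i - 1) (op_powi U n x))"
    using op_powi_Suc[of "i - 1 + n" x] op_powi_Suc[of "i - 1"] by (simp add: algebra_simps)
  then show ?case using inj_U by (simp add: inj_eq)
qed simp

lemma op_powi_U: "op_powi U m (U x) = op_powi U (m + 1) x"
  using op_powi_Suc[of 0 x] by (simp add: op_powi_add)

lemma op_powi_clinear: "Vector_Spaces.linear scaleC scaleC (op_powi U m)"
proof (rule clinearI)
  show "op_powi U m (x + y) = op_powi U m x + op_powi U m y" for x y
  proof (induction m rule: int_induct[where k = 0])
    case (step1 i)
    then show ?case by (simp add: op_powi_Suc clinear_add[OF linear_U])
  next
    case (step2 i)
    then have "U (op_powi U (i - 1) (x + y)) = U (op_powi U (i - 1) x + op_powi U (i - 1) y)"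
      by (simp add: op_powi_Suc[symmetric] clinear_add[OF linear_U])
    then show ?case using inj_U by (simp add: inj_eq)
  qed simp
  show "op_powi U m (c *\<^sub>C x) = c *\<^sub>C op_powi U m x" for c x
  proof (induction m rule: int_induct[where k = 0])
    case (step1 i)
    then show ?case by (simp add: op_powi_Suc clinear_scaleC[OF linear_U])
  next
    case (step2 i)
    then have "U (op_powi U (i - 1) (c *\<^sub>C x)) = U (c *\<^sub>C op_powi U (i - 1) x)"
      by (simp add: op_powi_Suc[symmetric] clinear_scaleC[OF linear_U])
    then show ?case using inj_U by (simp add: inj_eq)
  qed simp
qed

lemmas op_powi_simps = clinear_add[OF op_powi_clinear] clinear_scaleC[OF op_powi_clinear]
  clinear_zero[OF op_powi_clinear] clinear_diff[OF op_powi_clinear] clinear_sum[OF op_powi_clinear]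

lemma cinner_op_powi: "cinner (op_powi U m x) y = cinner x (op_powi U (- m) y)"
proof (induction m arbitrary: y rule: int_induct[where k = 0])
  case (step1 i)
  have "inv U y = op_powi U (- 1) y" by (simp add: op_powi_def)
  then have "op_powi U (- i) (inv U y) = op_powi U (- (i + 1)) y"
    by (simp add: op_powi_add[symmetric])
  then show ?case using step1 by (simp only: op_powi_Suc cinner_U_left)
next
  case (step2 i)
  have "cinner (op_powi U (i - 1) x) y = cinner (U (op_powi U (i - 1) x)) (U y)"
    by (simp add: cinner_U)
  also have "\<dots> = cinner (op_powi U i x) (U y)" by (simp add: op_powi_Suc[symmetric])
  also have "\<dots> = cinner x (op_powi U (- (i - 1)) y)" by (simp add: step2 op_powi_U)
  finally show ?case .
qed simp

lemma cinner_op_powi_cancel: "cinner (op_powi U m x) (op_powi U m y) = cinner x y"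
  by (simp add: cinner_op_powi op_powi_add[symmetric])

lemma op_powi_orbit: "op_powi U m (orbit n) = orbit (m + n)"
  by (simp add: orbit_def op_powi_add)

lemma U_orbit: "U (orbit n) = orbit (n + 1)"
  by (simp add: orbit_def op_powi_Suc)

lemma orbit_0 [simp]: "orbit 0 = evec 0"
  by (simp add: orbit_def)

lemma Re_op_orbit: "Re_op (U ^^ n) (evec 0) = (1 / 2) *\<^sub>C (orbit (int n) + orbit (- int n))"
  and Im_op_orbit: "Im_op (U ^^ n) (evec 0) = (1 / (2 * \<i>)) *\<^sub>C (orbit (int n) - orbit (- int n))"
proof -
  have "adj (op_powi U (int n)) = op_powi U (- int n)"
    by (intro adj_eqI cinner_op_powi)
  then have "adj (U ^^ n) = op_powi U (- int n)" by (simp add: op_powi_def)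
  then show "Re_op (U ^^ n) (evec 0) = (1 / 2) *\<^sub>C (orbit (int n) + orbit (- int n))"
    "Im_op (U ^^ n) (evec 0) = (1 / (2 * \<i>)) *\<^sub>C (orbit (int n) - orbit (- int n))"
    by (auto simp: Re_op_def Im_op_def orbit_def op_powi_def)
qed

text \<open>The Laurent polynomials with exponents from \<open>a\<close> to \<open>b\<close>, evaluated at \<open>U\<close> and applied to
  the first basis vector.\<close>

definition laurent_span :: "int \<Rightarrow> int \<Rightarrow> ell2 set" where
  "laurent_span a b = cspan (orbit ` {a..b})"

lemma laurent_span_closed:
  "x \<in> laurent_span a b \<Longrightarrow> y \<in> laurent_span a b \<Longrightarrow> x + y \<in> laurent_span a b"
  "x \<in> laurent_span a b \<Longrightarrow> y \<in> laurent_span a b \<Longrightarrow> x - y \<in> laurent_span a b"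
  "x \<in> laurent_span a b \<Longrightarrow> c *\<^sub>C x \<in> laurent_span a b"
  "0 \<in> laurent_span a b"
  by (simp_all add: laurent_span_def cspan_def ell2.span_add ell2.span_diff ell2.span_scale
      ell2.span_zero)

lemma orbit_in_laurent_span: "a \<le> m \<Longrightarrow> m \<le> b \<Longrightarrow> orbit m \<in> laurent_span a b"
  by (auto simp: laurent_span_def cspan_def intro: ell2.span_base)

lemma laurent_span_mono:
  "x \<in> laurent_span a b \<Longrightarrow> a' \<le> a \<Longrightarrow> b \<le> b' \<Longrightarrow> x \<in> laurent_span a' b'"
  unfolding laurent_span_def cspan_def by (erule subsetD[OF ell2.span_mono, rotated]) auto

lemma laurent_span_induct [consumes 1, case_names zero step]:
  assumes "x \<in> laurent_span a b" "P 0"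
    "\<And>m c y. a \<le> m \<Longrightarrow> m \<le> b \<Longrightarrow> P y \<Longrightarrow> P (c *\<^sub>C orbit m + y)"
  shows "P x"
  using assms(1) unfolding laurent_span_def cspan_def
  by (induction rule: ell2.span_induct_alt) (auto intro: assms)

lemma op_powi_laurent_span:
  assumes "x \<in> laurent_span a b"
  shows "op_powi U m x \<in> laurent_span (m + a) (m + b)"
  using assms
proof (induction rule: laurent_span_induct)
  case (step n c y)
  then show ?case
    by (auto simp: op_powi_simps op_powi_orbit intro!: laurent_span_closed orbit_in_laurent_span)
qed (simp add: op_powi_simps laurent_span_closed)

lemma U_laurent_span: "x \<in> laurent_span a b \<Longrightarrow> U x \<in> laurent_span (a + 1) (b + 1)"
  using op_powi_laurent_span[of x a b 1] op_powi_Suc[of 0 x] by (simp add: add.commute)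

lemma orthogonal_laurent_span:
  assumes "y \<in> laurent_span a b" "\<And>m. a \<le> m \<Longrightarrow> m \<le> b \<Longrightarrow> cinner (orbit m) x = 0"
  shows "cinner y x = 0" "cinner x y = 0"
proof -
  show "cinner y x = 0"
    using assms(1) by (induction rule: laurent_span_induct) (auto simp: cinner_simps assms(2))
  then show "cinner x y = 0" by (subst cinner_commute) simp
qed

end

section \<open>The Szego recursion in the sequence space\<close>

lemma rho_ne_0: "cmod a < 1 \<Longrightarrow> rho a \<noteq> 0"
  using power_strict_mono[of "cmod a" 1 2] by (simp add: rho_def)

lemma rho_square: "cmod a < 1 \<Longrightarrow> rho a * rho a = 1 - a * cnj a"
proof -
  assume "cmod a < 1"
  then have "(cmod a)\<^sup>2 \<le> 1" by (simp add: power_le_one)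
  then have "rho a * rho a = complex_of_real (1 - (cmod a)\<^sup>2)"
    by (simp only: rho_def of_real_mult[symmetric]) simp
  also have "\<dots> = 1 - a * cnj a" by (simp add: complex_norm_square del: of_real_power)
  finally show ?thesis .
qed

lemma cnj_rho [simp]: "cnj (rho a) = rho a"
  by (simp add: rho_def)

text \<open>The vectors \<open>\<phi>\<^sub>k(U) e\<close> and \<open>\<phi>\<^sub>k\<^sup>*(U) e\<close>, where \<open>\<phi>\<^sub>k\<close> is the \<open>k\<close>-th orthonormal polynomial.\<close>

fun szego :: "(ell2 \<Rightarrow> ell2) \<Rightarrow> (nat \<Rightarrow> complex) \<Rightarrow> nat \<Rightarrow> ell2 \<times> ell2" where
  "szego U \<alpha> 0 = (evec 0, evec 0)"
| "szego U \<alpha> (Suc k) =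
     ((1 / rho (\<alpha> k)) *\<^sub>C (U (fst (szego U \<alpha> k)) - cnj (\<alpha> k) *\<^sub>C snd (szego U \<alpha> k)),
      (1 / rho (\<alpha> k)) *\<^sub>C (snd (szego U \<alpha> k) - \<alpha> k *\<^sub>C U (fst (szego U \<alpha> k))))"

text \<open>This stands for \<open>x = f(U) e\<close>. Vectors are matched with functions through their inner
  products with the orbit of \<open>e\<close> and with the powers of \<open>z\<close>; the power \<open>z powi (- m)\<close> is the complex
  conjugate of \<open>z powi m\<close> on the unit circle.\<close>

definition represents ::
    "(ell2 \<Rightarrow> ell2) \<Rightarrow> complex measure \<Rightarrow> (complex \<Rightarrow> complex) \<Rightarrow> ell2 \<Rightarrow> bool" where
  "represents U \<mu> f x \<longleftrightarrow> continuous_on (sphere 0 1) f \<and>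
     (\<forall>m. cinner (op_powi U m (evec 0)) x = (\<integral>z. z powi (- m) * f z \<partial>\<mu>))"

lemma spectral_integrable:
  fixes f :: "complex \<Rightarrow> complex"
  assumes "spectral_measure U v \<mu>" "continuous_on (sphere 0 1) f"
  shows "integrable \<mu> f"
proof -
  interpret prob_space \<mu> using assms(1) by (simp add: spectral_measure_def)
  have space: "space \<mu> = sphere 0 1"
    and sets: "sets \<mu> = sets (restrict_space borel (sphere 0 1))"
    using assms(1) by (auto simp: spectral_measure_def)
  have "compact (f ` sphere 0 1)" by (intro compact_continuous_image assms(2) compact_sphere)
  then obtain K where K: "\<And>z. z \<in> sphere 0 1 \<Longrightarrow> norm (f z) \<le> K"
    by (meson bounded_iff compact_imp_bounded imageI)
  have "f \<in> borel_measurable (restrict_space borel (sphere 0 1))"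
    by (rule borel_measurable_continuous_on_restrict[OF assms(2)])
  then have "f \<in> borel_measurable \<mu>"
    using measurable_cong_sets[OF sets refl] by blast
  moreover have "AE z in \<mu>. norm (f z) \<le> K" by (intro AE_I2) (simp add: space K)
  ultimately show ?thesis by - (rule integrable_const_bound[of f K])
qed

lemma represents_cong:
  assumes "spectral_measure U v \<mu>" "represents U \<mu> f x" "\<And>z. cmod z = 1 \<Longrightarrow> f z = g z"
  shows "represents U \<mu> g x"
proof -
  have space: "space \<mu> = sphere 0 1" using assms(1) by (simp add: spectral_measure_def)
  have "(\<integral>z. z powi m * f z \<partial>\<mu>) = (\<integral>z. z powi m * g z \<partial>\<mu>)" for m
    by (rule Bochner_Integration.integral_cong) (auto simp: space assms(3))
  moreover have "continuous_on (sphere 0 1) f \<longleftrightarrow> continuous_on (sphere 0 1) g"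
    by (rule continuous_on_cong) (auto simp: assms(3))
  ultimately show ?thesis using assms(2) by (simp add: represents_def)
qed

lemma continuous_on_powi_sphere [continuous_intros]:
  "continuous_on (sphere 0 1) (\<lambda>z::complex. z powi m)"
  by (intro continuous_on_power_int continuous_intros) auto

lemma represents_diff:
  assumes "spectral_measure U v \<mu>" "represents U \<mu> f x" "represents U \<mu> g y"
  shows "represents U \<mu> (\<lambda>z. f z - g z) (x - y)"
proof -
  have c: "continuous_on (sphere 0 1) f" "continuous_on (sphere 0 1) g"
    using assms by (auto simp: represents_def)
  have int: "integrable \<mu> (\<lambda>z. z powi m * f z)" "integrable \<mu> (\<lambda>z. z powi m * g z)" for m
    by (rule spectral_integrable[OF assms(1)],
        rule continuous_on_mult[OF continuous_on_powi_sphere], rule c)+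
  have "(\<integral>z. z powi m * (f z - g z) \<partial>\<mu>)
      = (\<integral>z. z powi m * f z \<partial>\<mu>) - (\<integral>z. z powi m * g z \<partial>\<mu>)" for m
    unfolding right_diff_distrib by (rule Bochner_Integration.integral_diff[OF int])
  then show ?thesis using assms(2,3) continuous_on_diff[OF c]
    by (simp add: represents_def cinner_diff_right)
qed

lemma represents_scaleC:
  assumes "represents U \<mu> f x"
  shows "represents U \<mu> (\<lambda>z. c * f z) (c *\<^sub>C x)"
proof -
  have "(\<integral>z. z powi m * (c * f z) \<partial>\<mu>) = c * (\<integral>z. z powi m * f z \<partial>\<mu>)" for m
    by (subst mult.left_commute) simp
  then show ?thesis using assms
    by (auto simp: represents_def cinner_simps intro!: continuous_intros)
qed

lemma powi_minus_circle: "cmod z = 1 \<Longrightarrow> z powi (- m) = cnj (z powi m)"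
proof -
  assume "cmod z = 1"
  then have "inverse z = cnj z"
    by (metis inverse_unique complex_norm_square one_power2 of_real_1)
  then show ?thesis
    by (cases "0 \<le> m") (auto simp: power_int_def complex_cnj_power[symmetric] simp del: complex_cnj_power)
qed

lemma represents_one:
  assumes "spectral_measure U (evec 0) \<mu>"
  shows "represents U \<mu> (\<lambda>_. 1) (evec 0)"
proof -
  have space: "space \<mu> = sphere 0 1"
    and moments: "cinner (evec 0) (op_powi U m (evec 0)) = (\<integral>z. z powi m \<partial>\<mu>)" for m
    using assms by (auto simp: spectral_measure_def)
  have "cinner (op_powi U m (evec 0)) (evec 0) = (\<integral>z. z powi (- m) * 1 \<partial>\<mu>)" for m
  proof -
    have "cinner (op_powi U m (evec 0)) (evec 0) = cnj (\<integral>z. z powi m \<partial>\<mu>)"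
      by (subst cinner_commute) (simp only: moments)
    also have "\<dots> = (\<integral>z. cnj (z powi m) \<partial>\<mu>)" by (rule Bochner_Integration.integral_cnj[symmetric])
    also have "\<dots> = (\<integral>z. z powi (- m) * 1 \<partial>\<mu>)"
      by (rule Bochner_Integration.integral_cong) (simp_all add: space powi_minus_circle)
    finally show ?thesis .
  qed
  then show ?thesis by (simp add: represents_def)
qed

lemma (in unitary_operator) represents_U:
  assumes "spectral_measure U v \<mu>" "represents U \<mu> f x"
  shows "represents U \<mu> (\<lambda>z. z * f z) (U x)"
proof -
  have space: "space \<mu> = sphere 0 1" using assms(1) by (simp add: spectral_measure_def)
  have "cinner (op_powi U m (evec 0)) (U x) = (\<integral>z. z powi (- m) * (z * f z) \<partial>\<mu>)" for m
  proof -
    have "cinner (op_powi U m (evec 0)) (U x) = cinner (op_powi U (m - 1) (evec 0)) x"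
      using cinner_U[of "op_powi U (m - 1) (evec 0)" x] op_powi_Suc[of "m - 1"] by simp
    also have "\<dots> = (\<integral>z. z powi (- (m - 1)) * f z \<partial>\<mu>)"
      using assms(2) by (simp add: represents_def)
    also have "\<dots> = (\<integral>z. z powi (- m) * (z * f z) \<partial>\<mu>)"
    proof (rule Bochner_Integration.integral_cong)
      fix z assume "z \<in> space \<mu>"
      then have "z \<noteq> 0" by (auto simp: space)
      then show "z powi (- (m - 1)) * f z = z powi (- m) * (z * f z)"
        using power_int_add_1[of z "- m"] by simp
    qed simp
    finally show ?thesis .
  qed
  with assms(2) show ?thesis by (auto simp: represents_def intro!: continuous_intros)
qed

lemma dual_poly_circle:
  assumes "cmod z = 1"
  shows "dual_poly k p z = z ^ k * cnj (poly p z)"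
proof -
  have "1 / cnj z = z" using assms powi_minus_circle[of "cnj z" 1] by (simp add: divide_inverse)
  then show ?thesis by (simp add: dual_poly_def)
qed

text \<open>On the unit circle, \<open>\<Phi>\<^sub>k\<^sup>*(z)\<close> is \<open>z\<^sup>k\<close> times the conjugate of \<open>\<Phi>\<^sub>k(z)\<close>. So the recursion for
  \<open>\<Phi>\<^sub>k\<^sup>*\<close> is \<open>z\<^sup>k\<^sup>+\<^sup>1\<close> times the conjugate of the recursion for \<open>\<Phi>\<^sub>k\<close>, and both follow from the one that
  defines the Verblunsky coefficients. The normalisation \<open>c\<close> is real, so conjugation does not change
  it.\<close>

lemma (in unitary_operator) szego_represents:
  assumes \<mu>: "spectral_measure U (evec 0) \<mu>"
    and monic: "\<And>k. monic_orthogonal_poly \<mu> k (\<Phi> k)"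
    and rec: "\<And>k z. z \<noteq> 0 \<Longrightarrow>
       poly (\<Phi> (Suc k)) z = z * poly (\<Phi> k) z - cnj (\<alpha> k) * dual_poly k (\<Phi> k) z"
  shows "\<exists>c::real. represents U \<mu> (\<lambda>z. c * poly (\<Phi> k) z) (fst (szego U \<alpha> k)) \<and>
    represents U \<mu> (\<lambda>z. z ^ k * cnj (c * poly (\<Phi> k) z)) (snd (szego U \<alpha> k))"
proof (induction k)
  case 0
  have "degree (\<Phi> 0) = 0" "lead_coeff (\<Phi> 0) = 1"
    using monic[of 0] by (auto simp: monic_orthogonal_poly_def)
  then have "poly (\<Phi> 0) z = 1" for z
    by (metis degree_0_id coeff_pCons_0 poly_1 one_pCons)
  then show ?case using represents_one[OF \<mu>] by (intro exI[of _ 1]) simp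
next
  case (Suc k)
  then obtain c :: real where
    phi: "represents U \<mu> (\<lambda>z. c * poly (\<Phi> k) z) (fst (szego U \<alpha> k))" and
    phis: "represents U \<mu> (\<lambda>z. z ^ k * cnj (c * poly (\<Phi> k) z)) (snd (szego U \<alpha> k))"
    by blast
  define r where "r = 1 / sqrt (1 - (cmod (\<alpha> k))\<^sup>2)"
  have r: "1 / rho (\<alpha> k) = complex_of_real r" by (simp add: rho_def r_def)
  have circle: "poly (\<Phi> (Suc k)) z = z * poly (\<Phi> k) z - cnj (\<alpha> k) * (z ^ k * cnj (poly (\<Phi> k) z))"
    if "cmod z = 1" for z
    using rec[of z k] that dual_poly_circle[OF that] by force
  have "represents U \<mu> (\<lambda>z. complex_of_real (r * c) * poly (\<Phi> (Suc k)) z) (fst (szego U \<alpha> (Suc k)))"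
    by (rule represents_cong[OF \<mu>], unfold szego.simps fst_conv r,
        rule represents_scaleC, rule represents_diff[OF \<mu>], rule represents_U[OF \<mu> phi],
        rule represents_scaleC, rule phis) (simp add: circle algebra_simps)
  moreover have "represents U \<mu> (\<lambda>z. z ^ Suc k * cnj (complex_of_real (r * c) * poly (\<Phi> (Suc k)) z))
      (snd (szego U \<alpha> (Suc k)))"
  proof (rule represents_cong[OF \<mu>], unfold szego.simps snd_conv r,
      rule represents_scaleC, rule represents_diff[OF \<mu>], rule phis,
      rule represents_scaleC, rule represents_U[OF \<mu> phi])
    fix z assume z: "cmod z = 1"
    have zz: "z * cnj z = 1" using z complex_norm_square[of z] by simp
    have zk: "z ^ k * cnj z ^ k = 1" using zz by (metis power_mult_distrib power_one)
    have "z ^ Suc k * cnj (poly (\<Phi> (Suc k)) z)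
        = (z * cnj z) * (z ^ k * cnj (poly (\<Phi> k) z))
          - \<alpha> k * (z * ((z ^ k * cnj z ^ k) * poly (\<Phi> k) z))"
      by (simp add: circle[OF z] algebra_simps)
    then have "z ^ Suc k * cnj (poly (\<Phi> (Suc k)) z)
        = z ^ k * cnj (poly (\<Phi> k) z) - \<alpha> k * (z * poly (\<Phi> k) z)"
      by (simp only: zz zk mult_1)
    then have "complex_of_real (r * c) * (z ^ Suc k * cnj (poly (\<Phi> (Suc k)) z))
        = complex_of_real (r * c) * (z ^ k * cnj (poly (\<Phi> k) z) - \<alpha> k * (z * poly (\<Phi> k) z))"
      by (simp only:)
    then show "complex_of_real r * (z ^ k * cnj (complex_of_real c * poly (\<Phi> k) z)
          - \<alpha> k * (z * (complex_of_real c * poly (\<Phi> k) z)))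
        = z ^ Suc k * cnj (complex_of_real (r * c) * poly (\<Phi> (Suc k)) z)"
      by (simp add: right_diff_distrib mult_ac)
  qed
  ultimately show ?case by blast
qed

text \<open>The second orthogonality is the conjugate of the first: pairing \<open>z\<^sup>m\<close> with \<open>\<Phi>\<^sub>k\<^sup>*\<close> is, up to
  conjugation, pairing \<open>z\<^sup>k\<^sup>-\<^sup>m\<close> with \<open>\<Phi>\<^sub>k\<close>.\<close>

lemma (in unitary_operator) szego_orthogonal:
  assumes \<mu>: "spectral_measure U (evec 0) \<mu>" and "verblunsky_coeffs \<mu> \<alpha>"
  shows "0 \<le> m \<Longrightarrow> m < int k \<Longrightarrow> cinner (orbit m) (fst (szego U \<alpha> k)) = 0"
    and "1 \<le> m \<Longrightarrow> m \<le> int k \<Longrightarrow> cinner (orbit m) (snd (szego U \<alpha> k)) = 0"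
proof -
  obtain \<Phi> where monic: "\<And>k. monic_orthogonal_poly \<mu> k (\<Phi> k)"
    and rec: "\<And>k z. z \<noteq> 0 \<Longrightarrow>
       poly (\<Phi> (Suc k)) z = z * poly (\<Phi> k) z - cnj (\<alpha> k) * dual_poly k (\<Phi> k) z"
    using assms(2) by (auto simp: verblunsky_coeffs_def)
  obtain c :: real where
    phi: "represents U \<mu> (\<lambda>z. c * poly (\<Phi> k) z) (fst (szego U \<alpha> k))" and
    phis: "represents U \<mu> (\<lambda>z. z ^ k * cnj (c * poly (\<Phi> k) z)) (snd (szego U \<alpha> k))"
    using szego_represents[OF \<mu> monic rec] by blast
  have space: "space \<mu> = sphere 0 1" using \<mu> by (simp add: spectral_measure_def)
  have orth: "(\<integral>z. z powi (- m) * poly (\<Phi> k) z \<partial>\<mu>) = 0" if "0 \<le> m" "m < int k" for m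
  proof -
    have "(\<integral>z. cnj (poly (monom 1 (nat m)) z) * poly (\<Phi> k) z \<partial>\<mu>) = 0"
      using monic[of k] that by (simp add: monic_orthogonal_poly_def degree_monom_eq)
    also have "(\<integral>z. cnj (poly (monom 1 (nat m)) z) * poly (\<Phi> k) z \<partial>\<mu>)
        = (\<integral>z. z powi (- m) * poly (\<Phi> k) z \<partial>\<mu>)"
    proof (rule Bochner_Integration.integral_cong)
      fix z assume "z \<in> space \<mu>"
      then have "z powi (- m) = cnj (z powi m)" by (simp add: space powi_minus_circle)
      also have "z powi m = z ^ nat m" using that by (simp add: power_int_def)
      finally show "cnj (poly (monom 1 (nat m)) z) * poly (\<Phi> k) z = z powi (- m) * poly (\<Phi> k) z"
        by (simp add: poly_monom)
    qed simp
    finally show ?thesis .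
  qed
  show "cinner (orbit m) (fst (szego U \<alpha> k)) = 0" if "0 \<le> m" "m < int k"
  proof -
    have "cinner (orbit m) (fst (szego U \<alpha> k)) = (\<integral>z. z powi (- m) * (c * poly (\<Phi> k) z) \<partial>\<mu>)"
      using phi by (simp add: represents_def orbit_def)
    also have "\<dots> = c * (\<integral>z. z powi (- m) * poly (\<Phi> k) z \<partial>\<mu>)"
      by (subst mult.left_commute) simp
    finally show ?thesis using orth[OF that] by simp
  qed
  show "cinner (orbit m) (snd (szego U \<alpha> k)) = 0" if m: "1 \<le> m" "m \<le> int k"
  proof -
    have "cinner (orbit m) (snd (szego U \<alpha> k))
        = (\<integral>z. z powi (- m) * (z ^ k * cnj (c * poly (\<Phi> k) z)) \<partial>\<mu>)"
      using phis by (simp add: represents_def orbit_def)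
    also have "\<dots> = (\<integral>z. cnj (c * (z powi (- (int k - m)) * poly (\<Phi> k) z)) \<partial>\<mu>)"
    proof (rule Bochner_Integration.integral_cong)
      fix z assume z: "z \<in> space \<mu>"
      then have "z \<noteq> 0" by (auto simp: space)
      then have "z powi (- m) * z ^ k = z powi (int k - m)"
        using power_int_add[of z "- m" "int k"] by simp
      also have "\<dots> = cnj (z powi (- (int k - m)))"
        using z powi_minus_circle[of z "- (int k - m)"] by (simp add: space)
      finally have "z powi (- m) * z ^ k = cnj (z powi (- (int k - m)))" .
      then show "z powi (- m) * (z ^ k * cnj (c * poly (\<Phi> k) z))
          = cnj (c * (z powi (- (int k - m)) * poly (\<Phi> k) z))"
        by (simp only: mult.assoc[symmetric] complex_cnj_mult) (simp only: mult_ac)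
    qed simp
    also have "\<dots> = cnj (c * (\<integral>z. z powi (- (int k - m)) * poly (\<Phi> k) z \<partial>\<mu>))"
      by (subst Bochner_Integration.integral_cnj) simp
    finally show ?thesis using orth[of "int k - m"] m by simp
  qed
qed

section \<open>Products of block diagonal matrices\<close>

lemma mat_mult_left_finite:
  "(\<And>k. n < k \<Longrightarrow> A i k = 0) \<Longrightarrow> (A \<odot> B) i j = (\<Sum>k\<le>n. A i k * B k j)"
  unfolding mat_mult_def by (rule suminf_finite) (auto simp: not_le)

lemma mat_mult_right_finite:
  "(\<And>k. n < k \<Longrightarrow> B k j = 0) \<Longrightarrow> (A \<odot> B) i j = (\<Sum>k\<le>n. A i k * B k j)"
  unfolding mat_mult_def by (rule suminf_finite) (auto simp: not_le)

lemma sum_two_terms: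
  assumes "p < n" "\<And>k. k \<noteq> p \<Longrightarrow> k \<noteq> Suc p \<Longrightarrow> g k = 0"
  shows "(\<Sum>k\<le>n. g k) = g p + (g (Suc p) :: 'a :: comm_monoid_add)"
proof -
  have "(\<Sum>k\<le>n. g k) = (\<Sum>k\<in>{p, Suc p}. g k)"
    using assms by (intro sum.mono_neutral_right) auto
  then show ?thesis by simp
qed

lemma diag2_band: "Suc i < j \<or> Suc j < i \<Longrightarrow> diag2 B i j = 0"
  unfolding diag2_def by (rule if_not_P) presburger

lemma diag12_band: "Suc i < j \<or> Suc j < i \<Longrightarrow> diag12 B i j = 0"
  by (cases i; cases j) (auto simp: diag2_band)

lemma diag2_mult:
  "diag2 B \<odot> diag2 C = diag2 (\<lambda>m i j. B m i 0 * C m 0 j + B m i 1 * C m 1 j)"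
proof (intro ext)
  fix i j :: nat
  have "(diag2 B \<odot> diag2 C) i j = (\<Sum>k\<le>Suc i. diag2 B i k * diag2 C k j)"
    by (rule mat_mult_left_finite) (simp add: diag2_band)
  also have "\<dots> = diag2 B i (2 * (i div 2)) * diag2 C (2 * (i div 2)) j
      + diag2 B i (Suc (2 * (i div 2))) * diag2 C (Suc (2 * (i div 2))) j"
  proof (rule sum_two_terms)
    fix k assume "k \<noteq> 2 * (i div 2)" "k \<noteq> Suc (2 * (i div 2))"
    then have "i div 2 \<noteq> k div 2" by presburger
    then show "diag2 B i k * diag2 C k j = 0" by (simp add: diag2_def)
  qed presburger
  finally show "(diag2 B \<odot> diag2 C) i j
      = diag2 (\<lambda>m i j. B m i 0 * C m 0 j + B m i 1 * C m 1 j) i j"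
    by (simp add: diag2_def)
qed

lemma diag12_mult:
  "diag12 B \<odot> diag12 C = diag12 (\<lambda>m i j. B m i 0 * C m 0 j + B m i 1 * C m 1 j)"
proof (intro ext)
  fix i j :: nat
  have sum: "(diag12 B \<odot> diag12 C) i j = (\<Sum>k\<le>Suc i. diag12 B i k * diag12 C k j)"
    by (rule mat_mult_left_finite) (simp add: diag12_band)
  show "(diag12 B \<odot> diag12 C) i j = diag12 (\<lambda>m i j. B m i 0 * C m 0 j + B m i 1 * C m 1 j) i j"
  proof (cases i)
    case 0
    with sum show ?thesis by (cases j) simp_all
  next
    case (Suc i')
    show ?thesis
    proof (cases j)
      case 0
      have "diag12 B i k * diag12 C k j = 0" for k
        by (cases k) (simp_all add: 0 Suc)
      then have "(diag12 B \<odot> diag12 C) i j = 0" unfolding sum by (intro sum.neutral) blast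
      then show ?thesis by (simp add: 0 Suc)
    next
      case (Suc j')
      note j = Suc
      have "(diag12 B \<odot> diag12 C) i j = (\<Sum>k\<le>Suc i'. diag2 B i' k * diag2 C k j')"
        using sum unfolding \<open>i = Suc i'\<close> Suc by (subst (asm) sum.atMost_Suc_shift) simp
      also have "\<dots> = (diag2 B \<odot> diag2 C) i' j'"
        by (rule mat_mult_left_finite[symmetric]) (simp add: diag2_band)
      finally show ?thesis by (simp add: diag2_mult j \<open>i = Suc i'\<close>)
    qed
  qed
qed

lemma mat_dagger_diag12: "mat_dagger (diag12 B) = diag12 (\<lambda>m. mat_dagger (B m))"
proof (intro ext)
  fix i j
  show "mat_dagger (diag12 B) i j = diag12 (\<lambda>m. mat_dagger (B m)) i j"
    by (cases i; cases j) (auto simp: mat_dagger_def diag2_def)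
qed

lemma diag12_eq_mat_id:
  assumes "\<And>m i j. i < 2 \<Longrightarrow> j < 2 \<Longrightarrow> B m i j = (if i = j then 1 else 0)"
  shows "diag12 B = mat_id"
proof (intro ext)
  fix i j
  have "diag2 B i j = (if i = j then 1 else 0)" for i j
  proof (cases "i div 2 = j div 2")
    case True
    then have "i mod 2 = j mod 2 \<longleftrightarrow> i = j" by (metis div_mult_mod_eq)
    with True show ?thesis by (simp add: diag2_def assms)
  qed (auto simp: diag2_def)
  then show "diag12 B i j = mat_id i j"
    by (cases i; cases j) (simp_all add: mat_id_def)
qed

text \<open>Since \<open>2 - a - cnj a\<close> is the sum of \<open>\<bar>1 - a\<bar>\<^sup>2\<close> and \<open>1 - \<bar>a\<bar>\<^sup>2\<close>, the two identities for \<open>c\<close> and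
  \<open>r\<close> make the rows and columns of the block unit vectors.\<close>

lemma Psi_entries:
  fixes a :: complex
  assumes a: "cmod a < 1"
  obtains c r :: real where "c > 0" "r > 0" "rho a = r"
    "Psi a 0 0 = c * (\<i> * (1 - cnj a))" "Psi a 0 (Suc 0) = c * (- \<i> * r)"
    "Psi a (Suc 0) 0 = complex_of_real c * r" "Psi a (Suc 0) (Suc 0) = c * (1 - a)"
    "complex_of_real c * c * (2 - a - cnj a) = 1" "complex_of_real r * r = 1 - a * cnj a"
proof
  have pos: "1 - Re a > 0" using complex_Re_le_cmod[of a] a by linarith
  let ?c = "1 / sqrt (2 * (1 - Re a))" and ?r = "sqrt (1 - (cmod a)\<^sup>2)"
  show "?c > 0" using pos by simp
  show "?r > 0" using power_strict_mono[OF a, of 2] by simp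
  show "rho a = ?r" by (simp add: rho_def)
  then show "Psi a 0 0 = ?c * (\<i> * (1 - cnj a))" "Psi a 0 (Suc 0) = ?c * (- \<i> * ?r)"
    "Psi a (Suc 0) 0 = complex_of_real ?c * ?r" "Psi a (Suc 0) (Suc 0) = ?c * (1 - a)"
    by (simp_all add: Psi_def mat2_def)
  have "2 - a - cnj a = complex_of_real (2 * (1 - Re a))"
    by (simp add: complex_eq_iff)
  moreover have "?c * ?c * (2 * (1 - Re a)) = 1" using pos by (simp add: field_simps)
  ultimately show "complex_of_real ?c * ?c * (2 - a - cnj a) = 1"
    by (metis of_real_1 of_real_mult)
  show "complex_of_real ?r * ?r = 1 - a * cnj a"
    using rho_square[OF a] by (simp add: rho_def)
qed

lemma Psi_unitary:
  assumes a: "cmod a < 1" and ij: "i < 2" "j < 2"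
  shows "cnj (Psi a 0 i) * Psi a 0 j + cnj (Psi a 1 i) * Psi a 1 j = (if i = j then 1 else 0)"
    and "Psi a i 0 * cnj (Psi a j 0) + Psi a i 1 * cnj (Psi a j 1) = (if i = j then 1 else 0)"
proof -
  obtain c r :: real where P: "Psi a 0 0 = c * (\<i> * (1 - cnj a))" "Psi a 0 (Suc 0) = c * (- \<i> * r)"
    "Psi a (Suc 0) 0 = complex_of_real c * r" "Psi a (Suc 0) (Suc 0) = c * (1 - a)"
    and cc: "complex_of_real c * c * (2 - a - cnj a) = 1"
    and rr: "complex_of_real r * r = 1 - a * cnj a"
    using Psi_entries[OF a] by metis
  define b C R where defs: "b = cnj a" "C = complex_of_real c" "R = complex_of_real r"
  have Q: "cnj (Psi a 0 0) = C * (- \<i> * (1 - a))" "cnj (Psi a 0 (Suc 0)) = C * (\<i> * R)"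
    "cnj (Psi a (Suc 0) 0) = C * R" "cnj (Psi a (Suc 0) (Suc 0)) = C * (1 - b)"
    unfolding P by (simp_all add: defs)
  note P = P[folded defs]
  have CC: "C * C * (2 - a - b) = 1" and RR: "R * R = 1 - a * b"
    using cc rr by (simp_all add: defs)
  have II: "\<i> * \<i> = (- 1 :: complex)" by simp
  have cols: "C * (- \<i> * (1 - a)) * (C * (\<i> * (1 - b))) + C * R * (C * R) = 1"
    "C * (\<i> * R) * (C * (- \<i> * R)) + C * (1 - b) * (C * (1 - a)) = 1"
    "C * (- \<i> * (1 - a)) * (C * (- \<i> * R)) + C * R * (C * (1 - a)) = 0"
    "C * (\<i> * R) * (C * (\<i> * (1 - b))) + C * (1 - b) * (C * R) = 0"
    using CC RR II by algebra+
  have rows: "C * (\<i> * (1 - b)) * (C * (- \<i> * (1 - a))) + C * (- \<i> * R) * (C * (\<i> * R)) = 1"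
    "C * R * (C * R) + C * (1 - a) * (C * (1 - b)) = 1"
    "C * (\<i> * (1 - b)) * (C * R) + C * (- \<i> * R) * (C * (1 - b)) = 0"
    "C * R * (C * (- \<i> * (1 - a))) + C * (1 - a) * (C * (\<i> * R)) = 0"
    using CC RR II by algebra+
  have cases: "i = 0 \<and> j = 0 \<or> i = 0 \<and> j = Suc 0 \<or> i = Suc 0 \<and> j = 0 \<or> i = Suc 0 \<and> j = Suc 0"
    using ij by auto
  then show "cnj (Psi a 0 i) * Psi a 0 j + cnj (Psi a 1 i) * Psi a 1 j = (if i = j then 1 else 0)"
    by (elim disjE conjE) (simp_all only: Q One_nat_def,
        simp_all only: P cols nat.distinct if_False if_True simp_thms)
  show "Psi a i 0 * cnj (Psi a j 0) + Psi a i 1 * cnj (Psi a j 1) = (if i = j then 1 else 0)"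
    using cases
    by (elim disjE conjE) (simp_all only: Q One_nat_def,
        simp_all only: P rows nat.distinct if_False if_True simp_thms)
qed

lemma Nmat_unitary:
  assumes "\<And>k. cmod (\<alpha> k) < 1"
  shows "unitary_matrix (Nmat \<alpha>)"
  unfolding unitary_matrix_def Nmat_def mat_dagger_diag12 diag12_mult
  by (intro conjI diag12_eq_mat_id; simp only: mat_dagger_def complex_cnj_cnj Psi_unitary[OF assms])

lemma Lmat_transpose: "mat_transpose (Lmat \<alpha>) = Lmat \<alpha>"
proof (intro ext)
  fix i j :: nat
  have "i mod 2 = 0 \<or> i mod 2 = 1" "j mod 2 = 0 \<or> j mod 2 = 1" by auto
  then show "mat_transpose (Lmat \<alpha>) i j = Lmat \<alpha> i j"
    by (auto simp: mat_transpose_def Lmat_def diag2_def Xi_def mat2_def)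
qed

text \<open>The rows of \<open>Nmat \<alpha>\<close> end next to the diagonal, so both infinite sums are finite. In this
  form the symmetry and the bandwidth \<open>1 + 1 + 1\<close> are read off.\<close>

lemma Smat_eq_sum:
  "Smat \<alpha> j k = (\<Sum>a\<le>Suc j. \<Sum>b\<le>Suc k. Nmat \<alpha> j a * Lmat \<alpha> a b * Nmat \<alpha> k b)"
proof -
  have "Smat \<alpha> j k = (\<Sum>b\<le>Suc k. (Nmat \<alpha> \<odot> Lmat \<alpha>) j b * Nmat \<alpha> k b)"
    unfolding Smat_def
    by (subst mat_mult_right_finite[of "Suc k"]) (auto simp: mat_transpose_def Nmat_def diag12_band)
  also have "\<dots> = (\<Sum>b\<le>Suc k. (\<Sum>a\<le>Suc j. Nmat \<alpha> j a * Lmat \<alpha> a b) * Nmat \<alpha> k b)"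
    by (subst mat_mult_left_finite[of "Suc j"]) (auto simp: Nmat_def diag12_band)
  also have "\<dots> = (\<Sum>b\<le>Suc k. \<Sum>a\<le>Suc j. Nmat \<alpha> j a * Lmat \<alpha> a b * Nmat \<alpha> k b)"
    by (simp only: sum_distrib_right)
  finally show ?thesis by (subst sum.swap)
qed

lemma Smat_band: "\<bar>int j - int k\<bar> > 3 \<Longrightarrow> Smat \<alpha> j k = 0"
proof -
  assume far: "\<bar>int j - int k\<bar> > 3"
  have "Nmat \<alpha> j a * Lmat \<alpha> a b * Nmat \<alpha> k b = 0" for a b
  proof -
    have "(Suc j < a \<or> Suc a < j) \<or> (Suc a < b \<or> Suc b < a) \<or> (Suc k < b \<or> Suc b < k)"
      using far by linarith
    then show ?thesis by (auto simp: Nmat_def Lmat_def diag12_band diag2_band)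
  qed
  then show ?thesis unfolding Smat_eq_sum by (intro sum.neutral ballI) blast
qed

lemma Smat_transpose: "mat_transpose (Smat \<alpha>) = Smat \<alpha>"
proof (intro ext)
  fix j k
  have L: "Lmat \<alpha> a b = Lmat \<alpha> b a" for a b
    using Lmat_transpose by (metis mat_transpose_def)
  have "mat_transpose (Smat \<alpha>) j k
      = (\<Sum>b\<le>Suc j. \<Sum>a\<le>Suc k. Nmat \<alpha> k a * Lmat \<alpha> a b * Nmat \<alpha> j b)"
    unfolding mat_transpose_def Smat_eq_sum by (rule sum.swap)
  also have "\<dots> = Smat \<alpha> j k"
    unfolding Smat_eq_sum by (intro sum.cong refl) (simp add: L mult_ac)
  finally show "mat_transpose (Smat \<alpha>) j k = Smat \<alpha> j k" .
qed

section \<open>Gram--Schmidt orthonormalization\<close>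

lemma orthonormal_span_expansion:
  fixes s :: "nat \<Rightarrow> ell2"
  assumes "\<And>j k. cinner (s j) (s k) = (if j = k then 1 else 0)" and "x \<in> cspan (s ` {..<k})"
  shows "x = (\<Sum>j<k. cinner (s j) x *\<^sub>C s j)"
  using assms(2) unfolding cspan_def
proof (induction rule: ell2.span_induct_alt)
  case (step c x y)
  then obtain i where i: "i < k" "x = s i" by auto
  have "(\<Sum>j<k. cinner (s j) (c *\<^sub>C x + y) *\<^sub>C s j)
      = (\<Sum>j<k. (if j = i then c *\<^sub>C s i else 0) + cinner (s j) y *\<^sub>C s j)"
    by (intro sum.cong refl)
       (auto simp: cinner_simps assms(1) i ell2.scale_left_distrib)
  also have "\<dots> = c *\<^sub>C x + (\<Sum>j<k. cinner (s j) y *\<^sub>C s j)"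
    using i by (simp add: sum.distrib)
  finally show ?case using step by simp
qed simp

text \<open>An orthonormal sequence in which each \<open>v k\<close> has a positive leading coefficient is the result of
  the procedure: the expansion of \<open>v k\<close> in this sequence exhibits the normalised remainder.\<close>

lemma gram_schmidt_unique:
  assumes orth: "\<And>j k. cinner (s j) (s k) = (if j = k then 1 else 0)"
    and leading: "\<And>k. \<exists>a::real. (0::real) < a \<and> v k - complex_of_real a *\<^sub>C s k \<in> cspan (s ` {..<k})"
  shows "gram_schmidt v k = s k"
proof (induction k rule: less_induct)
  case (less k)
  obtain a :: real where a: "(0::real) < a" and t: "v k - complex_of_real a *\<^sub>C s k \<in> cspan (s ` {..<k})"
    using leading by blast
  have "cinner (s j) (v k - a *\<^sub>C s k) = cinner (s j) (v k)" if "j < k" for j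
    using that by (simp add: cinner_simps orth)
  then have "v k - a *\<^sub>C s k = (\<Sum>j<k. cinner (s j) (v k) *\<^sub>C s j)"
    using orthonormal_span_expansion[OF orth t] by simp
  moreover have "(\<Sum>j<k. cinner (gram_schmidt v j) (v k) *\<^sub>C gram_schmidt v j)
      = (\<Sum>j<k. cinner (s j) (v k) *\<^sub>C s j)"
    by (intro sum.cong refl) (simp add: less)
  ultimately have w: "v k - (\<Sum>j<k. cinner (gram_schmidt v j) (v k) *\<^sub>C gram_schmidt v j) = a *\<^sub>C s k"
    by (metis diff_add_cancel add_diff_cancel_left')
  have "complex_of_real ((norm (s k))\<^sup>2) = 1"
    using orth[of k k] by (simp only: cinner_self) simp
  then have "(norm (s k))\<^sup>2 = 1\<^sup>2" by (simp only: of_real_eq_1_iff) simp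
  then have "norm (s k) = 1" by (subst (asm) power2_eq_iff_nonneg) auto
  then have "norm (a *\<^sub>C s k) = a" using a by (simp add: norm_scaleC)
  then show ?case using a
    by (subst gram_schmidt.simps) (simp add: w scaleR_eq_scaleC Let_def)
qed

section \<open>The two CMV bases\<close>

text \<open>The orthogonality relations say that \<open>\<alpha>\<close> is the sequence of Verblunsky coefficients of \<open>U\<close>; they
  hold for the spectral measure by \<open>szego_orthogonal\<close>.\<close>

locale cmv_system = unitary_operator +
  fixes \<alpha> :: "nat \<Rightarrow> complex"
  assumes disk: "cmod (\<alpha> k) < 1"
    and orbit_orth_phi: "0 \<le> m \<Longrightarrow> m < int k \<Longrightarrow> cinner (orbit m) (fst (szego U \<alpha> k)) = 0"
    and orbit_orth_phis: "1 \<le> m \<Longrightarrow> m \<le> int k \<Longrightarrow> cinner (orbit m) (snd (szego U \<alpha> k)) = 0"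
begin

definition phi :: "nat \<Rightarrow> ell2" where "phi k = fst (szego U \<alpha> k)"
definition phis :: "nat \<Rightarrow> ell2" where "phis k = snd (szego U \<alpha> k)"

lemma phi_0 [simp]: "phi 0 = evec 0" "phis 0 = evec 0"
  by (simp_all add: phi_def phis_def)

lemma orbit_phi: "0 \<le> m \<Longrightarrow> m < int k \<Longrightarrow> cinner (orbit m) (phi k) = 0"
  and orbit_phis: "1 \<le> m \<Longrightarrow> m \<le> int k \<Longrightarrow> cinner (orbit m) (phis k) = 0"
  by (simp_all add: phi_def phis_def orbit_orth_phi orbit_orth_phis)

lemma phi_Suc: "phi (Suc k) = (1 / rho (\<alpha> k)) *\<^sub>C (U (phi k) - cnj (\<alpha> k) *\<^sub>C phis k)"
  and phis_Suc: "phis (Suc k) = (1 / rho (\<alpha> k)) *\<^sub>C (phis k - \<alpha> k *\<^sub>C U (phi k))"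
  by (simp_all add: phi_def phis_def)

lemma U_phi: "U (phi k) = rho (\<alpha> k) *\<^sub>C phi (Suc k) + cnj (\<alpha> k) *\<^sub>C phis k"
  and phis_eq: "phis k = rho (\<alpha> k) *\<^sub>C phis (Suc k) + \<alpha> k *\<^sub>C U (phi k)"
  using rho_ne_0[OF disk[of k]] by (simp_all add: phi_Suc phis_Suc)

text \<open>The leading coefficient of the orthonormal polynomial \<open>\<phi>\<^sub>k\<close>, which is also the constant
  coefficient of \<open>\<phi>\<^sub>k\<^sup>*\<close>.\<close>

definition kappa :: "nat \<Rightarrow> real" where
  "kappa k = (\<Prod>i<k. 1 / sqrt (1 - (cmod (\<alpha> i))\<^sup>2))"

lemma kappa_pos: "kappa k > 0"
  unfolding kappa_def using power_strict_mono[OF disk, where n = 2] by (intro prod_pos) simp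

lemma kappa_Suc: "complex_of_real (kappa (Suc k)) = (1 / rho (\<alpha> k)) * kappa k"
  by (simp add: kappa_def rho_def)

lemma evec_in_laurent_span: "a \<le> 0 \<Longrightarrow> 0 \<le> b \<Longrightarrow> evec 0 \<in> laurent_span a b"
  using orbit_in_laurent_span[of a 0 b] by simp

text \<open>The top power is isolated in \<open>phi k\<close> and the bottom power in \<open>phis k\<close>. After the shifts in the CMV
  bases, these become the two extreme exponents of a block.\<close>

lemma szego_leading:
  "phi k - kappa k *\<^sub>C orbit (int k) \<in> laurent_span 0 (int k - 1) \<and>
   phis k - kappa k *\<^sub>C orbit 0 \<in> laurent_span 1 (int k)"
proof (induction k)
  case 0
  then show ?case by (simp add: kappa_def laurent_span_closed)
next
  case (Suc k)
  define p q where "p = phi k - kappa k *\<^sub>C orbit (int k)" and "q = phis k - kappa k *\<^sub>C orbit 0"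
  have p: "p \<in> laurent_span 0 (int k - 1)" and q: "q \<in> laurent_span 1 (int k)"
    using Suc by (simp_all add: p_def q_def)
  have phi: "phi k = p + kappa k *\<^sub>C orbit (int k)" and phis: "phis k = q + kappa k *\<^sub>C orbit 0"
    by (simp_all add: p_def q_def)
  have Uphi: "U (phi k) = U p + kappa k *\<^sub>C orbit (int (Suc k))"
    by (simp add: phi clinear_add[OF linear_U] clinear_scaleC[OF linear_U] U_orbit add.commute)
  have Up: "U p \<in> laurent_span 1 (int k)"
    using U_laurent_span[OF p] by simp
  have "phi (Suc k) - kappa (Suc k) *\<^sub>C orbit (int (Suc k))
      = (1 / rho (\<alpha> k)) *\<^sub>C (U p - cnj (\<alpha> k) *\<^sub>C phis k)"
    unfolding phi_Suc Uphi kappa_Suc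
    by (simp add: ell2.scale_right_diff_distrib ell2.scale_right_distrib del: of_nat_Suc)
  also have "\<dots> \<in> laurent_span 0 (int k)"
    unfolding phis using Up q
    by (intro laurent_span_closed) (auto intro: laurent_span_mono orbit_in_laurent_span evec_in_laurent_span laurent_span_closed)
  finally have 1: "phi (Suc k) - kappa (Suc k) *\<^sub>C orbit (int (Suc k)) \<in> laurent_span 0 (int k)" .
  have "phis (Suc k) - kappa (Suc k) *\<^sub>C orbit 0
      = (1 / rho (\<alpha> k)) *\<^sub>C (q - \<alpha> k *\<^sub>C U (phi k))"
    unfolding phis_Suc kappa_Suc phis
    by (simp add: ell2.scale_right_diff_distrib ell2.scale_right_distrib del: orbit_0)
  also have "\<dots> \<in> laurent_span 1 (int (Suc k))"
    unfolding Uphi using Up q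
    by (intro laurent_span_closed) (auto intro: laurent_span_mono orbit_in_laurent_span evec_in_laurent_span laurent_span_closed)
  finally show ?case using 1 by simp
qed

lemma phi_in_span: "phi k \<in> laurent_span 0 (int k)" "phis k \<in> laurent_span 0 (int k)"
proof -
  have "phi k - kappa k *\<^sub>C orbit (int k) \<in> laurent_span 0 (int k)"
    "phis k - kappa k *\<^sub>C orbit 0 \<in> laurent_span 0 (int k)"
    using szego_leading[of k] by (auto elim: laurent_span_mono)
  then have "phi k - kappa k *\<^sub>C orbit (int k) + kappa k *\<^sub>C orbit (int k) \<in> laurent_span 0 (int k)"
    "phis k - kappa k *\<^sub>C orbit 0 + kappa k *\<^sub>C orbit 0 \<in> laurent_span 0 (int k)"
    by (intro laurent_span_closed(1) laurent_span_closed(3) orbit_in_laurent_span; simp)+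
  then show "phi k \<in> laurent_span 0 (int k)" "phis k \<in> laurent_span 0 (int k)"
    by (simp_all only: diff_add_cancel)
qed

text \<open>The recursion decomposes \<open>U (phi k)\<close> and \<open>phis k\<close> orthogonally, and Pythagoras gives the norms
  because \<open>\<rho>\<^sub>k\<^sup>2 = 1 - \<bar>\<alpha>\<^sub>k\<bar>\<^sup>2\<close>.\<close>

lemma szego_norm: "cinner (phi k) (phi k) = 1 \<and> cinner (phis k) (phis k) = 1"
proof (induction k)
  case (Suc k)
  let ?a = "\<alpha> k" and ?r = "rho (\<alpha> k)"
  have orth: "cinner (phi (Suc k)) (phis k) = 0" "cinner (phis k) (phi (Suc k)) = 0"
    by (rule orthogonal_laurent_span[OF phi_in_span(2)[of k]]; simp add: orbit_phi)+
  have "U (phi k) \<in> laurent_span 1 (int k + 1)" using U_laurent_span[OF phi_in_span(1)[of k]] by simp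
  then have orths: "cinner (phis (Suc k)) (U (phi k)) = 0" "cinner (U (phi k)) (phis (Suc k)) = 0"
    by (rule orthogonal_laurent_span; simp add: orbit_phis)+
  have Unorm: "cinner (U (phi k)) (U (phi k)) = 1" using Suc by (simp add: cinner_U)
  have rr: "?r * ?r + ?a * cnj ?a = 1" using rho_square[OF disk[of k]] by simp
  have "cinner (U (phi k)) (U (phi k)) = ?r * ?r * cinner (phi (Suc k)) (phi (Suc k)) + ?a * cnj ?a"
    unfolding U_phi using Suc by (simp add: cinner_simps orth)
  then have 1: "?r * ?r * cinner (phi (Suc k)) (phi (Suc k)) = ?r * ?r"
    unfolding Unorm using rr by (metis add_right_cancel)
  have "cinner (phis k) (phis k) = ?r * ?r * cinner (phis (Suc k)) (phis (Suc k)) + ?a * cnj ?a"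
    by (subst (1 2) phis_eq) (simp add: cinner_simps orths Unorm)
  then have 2: "?r * ?r * cinner (phis (Suc k)) (phis (Suc k)) = ?r * ?r"
    using rr Suc by (metis add_right_cancel)
  from 1 2 rho_ne_0[OF disk[of k]] show ?case by simp
qed simp

text \<open>The CMV basis, which comes from orthonormalizing \<open>1, z, z\<^sup>-\<^sup>1, z\<^sup>2, z\<^sup>-\<^sup>2, \<dots>\<close>, and the alternate
  one, which comes from \<open>1, z\<^sup>-\<^sup>1, z, z\<^sup>-\<^sup>2, z\<^sup>2, \<dots>\<close>. As functions on the circle, corresponding
  elements are complex conjugates of each other.\<close>

definition chi :: "nat \<Rightarrow> ell2" where
  "chi k = op_powi U (- int (k div 2)) (if even k then phis k else phi k)"

definition chi_alt :: "nat \<Rightarrow> ell2" where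
  "chi_alt k = op_powi U (- int ((k + 1) div 2)) (if even k then phi k else phis k)"

lemma chi_0 [simp]: "chi 0 = evec 0" "chi_alt 0 = evec 0"
  by (simp_all add: chi_def chi_alt_def)

lemma chi_odd: "chi (Suc (2 * m)) = op_powi U (- int (Suc m)) (U (phi (Suc (2 * m))))"
  and chi_alt_odd: "chi_alt (Suc (2 * m)) = op_powi U (- int (Suc m)) (phis (Suc (2 * m)))"
  and chi_even: "chi (2 * m) = op_powi U (- int m) (phis (2 * m))"
  and chi_alt_even: "chi_alt (2 * m) = op_powi U (- int m) (phi (2 * m))"
  by (simp_all add: chi_def chi_alt_def op_powi_U)

lemma chi_Suc_odd: "chi (Suc (Suc (2 * m))) = (1 / rho (\<alpha> (Suc (2 * m)))) *\<^sub>C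
      (chi_alt (Suc (2 * m)) - \<alpha> (Suc (2 * m)) *\<^sub>C chi (Suc (2 * m)))"
  and chi_alt_Suc_odd: "chi_alt (Suc (Suc (2 * m))) = (1 / rho (\<alpha> (Suc (2 * m)))) *\<^sub>C
      (chi (Suc (2 * m)) - cnj (\<alpha> (Suc (2 * m))) *\<^sub>C chi_alt (Suc (2 * m)))"
  using chi_even[of "Suc m"] chi_alt_even[of "Suc m"]
  by (simp_all add: chi_odd chi_alt_odd phi_Suc phis_Suc op_powi_simps)

lemma U_chi_alt_even:
  "U (chi_alt (2 * m)) = cnj (\<alpha> (2 * m)) *\<^sub>C chi (2 * m) + rho (\<alpha> (2 * m)) *\<^sub>C chi (Suc (2 * m))"
proof -
  have "U (chi_alt (2 * m)) = op_powi U (- int m) (U (phi (2 * m)))"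
    unfolding chi_alt_even op_powi_U by (rule op_powi_Suc[symmetric])
  also have "\<dots> = cnj (\<alpha> (2 * m)) *\<^sub>C chi (2 * m) + rho (\<alpha> (2 * m)) *\<^sub>C chi (Suc (2 * m))"
    unfolding U_phi by (simp add: op_powi_simps chi_def)
  finally show ?thesis .
qed

lemma U_chi_alt_odd:
  "U (chi_alt (Suc (2 * m))) = rho (\<alpha> (2 * m)) *\<^sub>C chi (2 * m) - \<alpha> (2 * m) *\<^sub>C chi (Suc (2 * m))"
proof -
  \<comment> \<open>Eliminate \<open>U (phi k)\<close> from the two formulas of the recursion.\<close>
  have eq: "phis (Suc k) = rho (\<alpha> k) *\<^sub>C phis k - \<alpha> k *\<^sub>C phi (Suc k)" for k
  proof (rule ell2_eqI)
    fix n
    have r: "rho (\<alpha> k) \<noteq> 0" "rho (\<alpha> k) * rho (\<alpha> k) = 1 - \<alpha> k * cnj (\<alpha> k)"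
      using rho_ne_0 rho_square disk by auto
    have "rho (\<alpha> k) * y - \<alpha> k * (1 / rho (\<alpha> k) * (x - cnj (\<alpha> k) * y))
        = 1 / rho (\<alpha> k) * (y - \<alpha> k * x)" for x y
    proof -
      have "rho (\<alpha> k) * y - \<alpha> k * (1 / rho (\<alpha> k) * (x - cnj (\<alpha> k) * y))
          = 1 / rho (\<alpha> k) * ((rho (\<alpha> k) * rho (\<alpha> k)) * y - \<alpha> k * (x - cnj (\<alpha> k) * y))"
        using r(1) by (simp add: right_diff_distrib)
      also have "\<dots> = 1 / rho (\<alpha> k) * (y - \<alpha> k * x)"
        unfolding r(2) by (simp add: algebra_simps)
      finally show ?thesis .
    qed
    then show "coord (phis (Suc k)) n = coord (rho (\<alpha> k) *\<^sub>C phis k - \<alpha> k *\<^sub>C phi (Suc k)) n"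
      by (simp only: phi_Suc phis_Suc coord_simps)
  qed
  have "U (chi_alt (Suc (2 * m))) = op_powi U (- int m) (phis (Suc (2 * m)))"
    unfolding chi_alt_odd op_powi_Suc[symmetric] by simp
  also have "\<dots> = rho (\<alpha> (2 * m)) *\<^sub>C chi (2 * m) - \<alpha> (2 * m) *\<^sub>C chi (Suc (2 * m))"
    unfolding eq by (simp add: op_powi_simps chi_def)
  finally show ?thesis .
qed

text \<open>The matrix \<open>Lmat \<alpha>\<close> represents \<open>U\<close> between the two bases. The Szego recursion for even \<open>k\<close>
  connects \<open>chi_alt k\<close> and \<open>chi_alt (k + 1)\<close> with \<open>chi k\<close> and \<open>chi (k + 1)\<close>, hence the blocks.\<close>

lemma U_chi_alt: "U (chi_alt b) = (\<Sum>a\<le>Suc b. Lmat \<alpha> a b *\<^sub>C chi a)"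
proof -
  obtain m where "b = 2 * m \<or> b = Suc (2 * m)" by (metis evenE oddE Suc_eq_plus1)
  then show ?thesis
  proof
    assume b: "b = 2 * m"
    have "(\<Sum>a\<le>Suc b. Lmat \<alpha> a b *\<^sub>C chi a)
        = Lmat \<alpha> b b *\<^sub>C chi b + Lmat \<alpha> (Suc b) b *\<^sub>C chi (Suc b)"
    proof (rule sum_two_terms)
      fix a assume "a \<noteq> b" "a \<noteq> Suc b"
      then have "a div 2 \<noteq> b div 2" unfolding b by presburger
      then show "Lmat \<alpha> a b *\<^sub>C chi a = 0" by (simp add: Lmat_def diag2_def)
    qed simp
    then show ?thesis by (simp add: b U_chi_alt_even Lmat_def diag2_def Xi_def mat2_def)
  next
    assume b: "b = Suc (2 * m)"
    have "(\<Sum>a\<le>Suc b. Lmat \<alpha> a b *\<^sub>C chi a)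
        = Lmat \<alpha> (2 * m) b *\<^sub>C chi (2 * m) + Lmat \<alpha> (Suc (2 * m)) b *\<^sub>C chi (Suc (2 * m))"
    proof (rule sum_two_terms)
      fix a assume "a \<noteq> 2 * m" "a \<noteq> Suc (2 * m)"
      then have "a div 2 \<noteq> b div 2" unfolding b by presburger
      then show "Lmat \<alpha> a b *\<^sub>C chi a = 0" by (simp add: Lmat_def diag2_def)
    qed (simp add: b)
    then show ?thesis by (simp add: b U_chi_alt_odd Lmat_def diag2_def Xi_def mat2_def)
  qed
qed

lemma chi_in_span: "chi k \<in> laurent_span (- int (k div 2)) (int ((k + 1) div 2))"
proof -
  have "chi k \<in> laurent_span (- int (k div 2) + 0) (- int (k div 2) + int k)"
    unfolding chi_def by (rule op_powi_laurent_span) (auto intro: phi_in_span)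
  moreover have "- int (k div 2) + int k = int ((k + 1) div 2)" by presburger
  ultimately show ?thesis by simp
qed

text \<open>The range of exponents contains all those that occur in \<open>chi j\<close> with \<open>j < k\<close>. Together with the
  norms, this makes \<open>chi\<close> orthonormal.\<close>

lemma chi_orth_orbit:
  assumes "- int ((k - 1) div 2) \<le> m" "m \<le> int (k div 2)" "0 < k"
  shows "cinner (orbit m) (chi k) = 0"
proof -
  have "cinner (orbit m) (chi k) = cinner (orbit (int (k div 2) + m)) (if even k then phis k else phi k)"
    unfolding chi_def using cinner_op_powi[of "int (k div 2)" "orbit m"] by (simp add: op_powi_orbit)
  also have "\<dots> = 0"
  proof (cases "even k")
    case True
    then have "1 \<le> int (k div 2) + m" "int (k div 2) + m \<le> int k" using assms by presburger+
    with True show ?thesis by (simp add: orbit_phis)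
  next
    case False
    then have "0 \<le> int (k div 2) + m" "int (k div 2) + m < int k" using assms by presburger+
    with False show ?thesis by (simp add: orbit_phi)
  qed
  finally show ?thesis .
qed

lemma chi_orthonormal: "cinner (chi j) (chi k) = (if j = k then 1 else 0)"
proof -
  have less: "cinner (chi j) (chi k) = 0 \<and> cinner (chi k) (chi j) = 0" if "j < k" for j k
  proof -
    have "cinner (orbit m) (chi k) = 0" if "- int (j div 2) \<le> m" "m \<le> int ((j + 1) div 2)" for m
    proof (rule chi_orth_orbit)
      have "j div 2 \<le> (k - 1) div 2" "(j + 1) div 2 \<le> k div 2"
        using \<open>j < k\<close> by (auto intro: div_le_mono)
      with that show "- int ((k - 1) div 2) \<le> m" "m \<le> int (k div 2)" by linarith+
    qed (use \<open>j < k\<close> in simp)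
    then show ?thesis using orthogonal_laurent_span[OF chi_in_span[of j]] by blast
  qed
  have "cinner (chi k) (chi k) = 1"
    by (simp add: chi_def cinner_op_powi_cancel szego_norm)
  with less[of j k] less[of k j] show ?thesis by (cases j k rule: linorder_cases) auto
qed

section \<open>The real basis\<close>

text \<open>The conjugated rows of \<open>Nmat \<alpha>\<close> are the coefficients that combine the two CMV functions of a
  block to real-valued functions on the circle.\<close>

definition real_basis :: "nat \<Rightarrow> ell2" where
  "real_basis k = (\<Sum>b\<le>Suc k. cnj (Nmat \<alpha> k b) *\<^sub>C chi b)"

lemma Nmat_row_0: "Nmat \<alpha> 0 b = (if b = 0 then 1 else 0)"
  by (cases b) (auto simp: Nmat_def)

lemma Nmat_block:
  assumes "i < 2" "j < 2"
  shows "Nmat \<alpha> (Suc (2 * m + i)) (Suc (2 * m + j)) = Psi (\<alpha> (Suc (2 * m))) i j"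
  using assms by (auto simp: Nmat_def diag2_def)

lemma Nmat_block_0:
  assumes "i < 2" "b \<noteq> Suc (2 * m)" "b \<noteq> Suc (Suc (2 * m))"
  shows "Nmat \<alpha> (Suc (2 * m + i)) b = 0"
proof (cases b)
  case (Suc b')
  have "b' div 2 \<noteq> m"
  proof
    assume "b' div 2 = m"
    then have "b' = 2 * m \<or> b' = Suc (2 * m)" by linarith
    with assms Suc show False by simp
  qed
  moreover have "(2 * m + i) div 2 = m" using assms by simp
  ultimately show ?thesis by (simp add: Suc Nmat_def diag2_def)
qed (simp add: Nmat_def)

lemma Nmat_row_sum:
  assumes "i < 2" "\<And>b. h 0 b = 0"
  shows "(\<Sum>b\<le>Suc (Suc (2 * m + i)). h (Nmat \<alpha> (Suc (2 * m + i)) b) b)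
     = h (Psi (\<alpha> (Suc (2 * m))) i 0) (Suc (2 * m)) +
      (h (Psi (\<alpha> (Suc (2 * m))) i (Suc 0)) (Suc (Suc (2 * m))) :: ell2)"
  using Nmat_block[OF assms(1), of 0 m] Nmat_block[OF assms(1), of 1 m]
  by (subst sum_two_terms[of "Suc (2 * m)"]) (auto simp: Nmat_block_0 assms)

lemma real_basis_block:
  assumes "i < 2"
  shows "real_basis (Suc (2 * m + i)) = cnj (Psi (\<alpha> (Suc (2 * m))) i 0) *\<^sub>C chi (Suc (2 * m))
    + cnj (Psi (\<alpha> (Suc (2 * m))) i (Suc 0)) *\<^sub>C chi (Suc (Suc (2 * m)))"
  unfolding real_basis_def using Nmat_row_sum[OF assms, of "\<lambda>c b. cnj c *\<^sub>C chi b" m] by simp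

text \<open>With \<open>\<chi>\<close> and \<open>a = \<alpha>\<close> at the index \<open>2 m + 1\<close>, the two vectors of a block are, as functions,
  \<open>2 c Im \<chi>\<close> and \<open>(2 c / r) Re ((1 - a) \<chi>)\<close>, since \<open>chi_alt\<close> is the conjugate of \<open>chi\<close>.
  The recursion step with odd index expresses the second element of each CMV basis in the block by the first elements, and \<open>r\<^sup>2 = 1 - \<bar>a\<bar>\<^sup>2\<close> cancels the rest.
  The last two equations are the conjugates of the definition: a real function has conjugate
  coefficients in the conjugate basis.\<close>

lemma real_basis_pair:
  obtains c r :: real where "c > 0" "r > 0"
    "real_basis (Suc (2 * m)) = c *\<^sub>C (- \<i> *\<^sub>C (chi (Suc (2 * m)) - chi_alt (Suc (2 * m))))"
    "real_basis (Suc (Suc (2 * m))) = (c / r) *\<^sub>C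
       ((1 - \<alpha> (Suc (2 * m))) *\<^sub>C chi (Suc (2 * m)) + (1 - cnj (\<alpha> (Suc (2 * m)))) *\<^sub>C chi_alt (Suc (2 * m)))"
    "real_basis (Suc (2 * m)) = (\<Sum>b\<le>Suc (Suc (2 * m)). Nmat \<alpha> (Suc (2 * m)) b *\<^sub>C chi_alt b)"
    "real_basis (Suc (Suc (2 * m))) =
      (\<Sum>b\<le>Suc (Suc (Suc (2 * m))). Nmat \<alpha> (Suc (Suc (2 * m))) b *\<^sub>C chi_alt b)"
proof -
  define a where "a = \<alpha> (Suc (2 * m))"
  obtain c r :: real where pos: "c > 0" "r > 0" and r: "rho a = r" and
    P: "Psi a 0 0 = c * (\<i> * (1 - cnj a))" "Psi a 0 (Suc 0) = c * (- \<i> * r)"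
    "Psi a (Suc 0) 0 = complex_of_real c * r" "Psi a (Suc 0) (Suc 0) = c * (1 - a)"
    and rr: "complex_of_real r * r = 1 - a * cnj a"
    using Psi_entries[of a] disk[of "Suc (2 * m)"] unfolding a_def by metis
  define p q where "p = chi (Suc (2 * m))" and "q = chi_alt (Suc (2 * m))"
  define C R b where defs: "C = complex_of_real c" "R = complex_of_real r" "b = cnj a"
  have R0: "R \<noteq> 0" using pos by (simp add: defs)
  have RR: "R * R = 1 - a * b" using rr by (simp add: defs)
  have chi2: "chi (Suc (Suc (2 * m))) = (1 / R) *\<^sub>C (q - a *\<^sub>C p)"
    and alt2: "chi_alt (Suc (Suc (2 * m))) = (1 / R) *\<^sub>C (p - b *\<^sub>C q)"
    using chi_Suc_odd[of m] chi_alt_Suc_odd[of m] by (simp_all add: a_def[symmetric] p_def q_def r defs)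
  have Pc: "cnj (Psi a 0 0) = C * (- \<i> * (1 - a))" "cnj (Psi a 0 (Suc 0)) = C * (\<i> * R)"
    "cnj (Psi a (Suc 0) 0) = C * R" "cnj (Psi a (Suc 0) (Suc 0)) = C * (1 - b)"
    unfolding P by (simp_all add: defs)
  note P = P[folded defs]
  note block = real_basis_block[of 0 m, folded a_def p_def] real_basis_block[of 1 m, folded a_def p_def]
  have s1: "real_basis (Suc (2 * m)) = C *\<^sub>C (- \<i> *\<^sub>C (p - q))"
  proof (rule ell2_eqI)
    fix n
    have "C * (- \<i> * (1 - a)) * x + C * (\<i> * R) * ((1 / R) * (y - a * x)) = C * (- \<i> * (x - y))"
      for x y using R0 by (simp add: field_simps)
    then show "coord (real_basis (Suc (2 * m))) n = coord (C *\<^sub>C (- \<i> *\<^sub>C (p - q))) n"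
      using block(1) by (simp only: Pc chi2 coord_simps add_0_right)
  qed
  have s2: "real_basis (Suc (Suc (2 * m))) = (C / R) *\<^sub>C ((1 - a) *\<^sub>C p + (1 - b) *\<^sub>C q)"
  proof (rule ell2_eqI)
    fix n
    have "C * R * x + C * (1 - b) * ((1 / R) * (y - a * x)) = C / R * ((1 - a) * x + (1 - b) * y)"
      for x y
    proof -
      have "C * R * x + C * (1 - b) * ((1 / R) * (y - a * x))
          = C / R * (R * R * x + (1 - b) * (y - a * x))" using R0 by (simp add: field_simps)
      also have "\<dots> = C / R * ((1 - a) * x + (1 - b) * y)" unfolding RR by (simp add: algebra_simps)
      finally show ?thesis .
    qed
    then show "coord (real_basis (Suc (Suc (2 * m)))) n
        = coord ((C / R) *\<^sub>C ((1 - a) *\<^sub>C p + (1 - b) *\<^sub>C q)) n"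
      using block(2) by (simp add: Pc chi2)
  qed
  have row: "(\<Sum>b\<le>Suc (Suc (2 * m)). Nmat \<alpha> (Suc (2 * m)) b *\<^sub>C chi_alt b)
      = Psi a 0 0 *\<^sub>C q + Psi a 0 (Suc 0) *\<^sub>C chi_alt (Suc (Suc (2 * m)))"
    using Nmat_row_sum[of 0 "\<lambda>c b. c *\<^sub>C chi_alt b" m, folded a_def q_def]
    by (simp del: sum.atMost_Suc)
  have t1: "(\<Sum>b\<le>Suc (Suc (2 * m)). Nmat \<alpha> (Suc (2 * m)) b *\<^sub>C chi_alt b) = C *\<^sub>C (- \<i> *\<^sub>C (p - q))"
  proof (rule ell2_eqI)
    fix n
    have "C * (\<i> * (1 - b)) * y + C * (- \<i> * R) * ((1 / R) * (x - b * y)) = C * (- \<i> * (x - y))"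
      for x y using R0 by (simp add: field_simps)
    then show "coord (\<Sum>b\<le>Suc (Suc (2 * m)). Nmat \<alpha> (Suc (2 * m)) b *\<^sub>C chi_alt b) n
        = coord (C *\<^sub>C (- \<i> *\<^sub>C (p - q))) n"
      by (simp only: row P alt2 coord_simps)
  qed
  have t2: "(\<Sum>b\<le>Suc (Suc (Suc (2 * m))). Nmat \<alpha> (Suc (Suc (2 * m))) b *\<^sub>C chi_alt b)
      = (C / R) *\<^sub>C ((1 - a) *\<^sub>C p + (1 - b) *\<^sub>C q)"
  proof (rule ell2_eqI)
    fix n
    have "C * R * y + C * (1 - a) * ((1 / R) * (x - b * y)) = C / R * ((1 - a) * x + (1 - b) * y)"
      for x y
    proof -
      have "C * R * y + C * (1 - a) * ((1 / R) * (x - b * y))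
          = C / R * (R * R * y + (1 - a) * (x - b * y))" using R0 by (simp add: field_simps)
      also have "\<dots> = C / R * ((1 - a) * x + (1 - b) * y)" unfolding RR by (simp add: algebra_simps)
      finally show ?thesis .
    qed
    then show "coord (\<Sum>b\<le>Suc (Suc (Suc (2 * m))). Nmat \<alpha> (Suc (Suc (2 * m))) b *\<^sub>C chi_alt b) n
        = coord ((C / R) *\<^sub>C ((1 - a) *\<^sub>C p + (1 - b) *\<^sub>C q)) n"
      using Nmat_row_sum[of 1 "\<lambda>c b. c *\<^sub>C chi_alt b" m, folded a_def q_def]
      by (simp add: P alt2 del: sum.atMost_Suc coord_sum)
  qed
  show ?thesis
    by (rule that[OF pos]) (simp_all only: s1 s2 t1 t2 a_def p_def q_def defs of_real_divide)
qed

lemma real_basis_0 [simp]: "real_basis 0 = evec 0"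
  by (simp add: real_basis_def Nmat_row_0)

lemma nat_cases_odd_even:
  fixes k :: nat
  obtains "k = 0" | m where "k = Suc (2 * m)" | m where "k = Suc (Suc (2 * m))"
  by (metis evenE oddE Suc_eq_plus1 not0_implies_Suc even_Suc)

lemma real_basis_alt: "real_basis k = (\<Sum>b\<le>Suc k. Nmat \<alpha> k b *\<^sub>C chi_alt b)"
  by (cases k rule: nat_cases_odd_even) (auto simp: Nmat_row_0 intro: real_basis_pair)

lemma cinner_real_basis_chi: "cinner (real_basis j) (chi a) = Nmat \<alpha> j a"
proof -
  have "cinner (real_basis j) (chi a) = (\<Sum>b\<le>Suc j. if b = a then Nmat \<alpha> j b else 0)"
    unfolding real_basis_def by (simp add: cinner_simps chi_orthonormal if_distrib cong: if_cong del: sum.atMost_Suc)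
  also have "\<dots> = Nmat \<alpha> j a" by (auto simp: Nmat_def diag12_band simp del: sum.atMost_Suc)
  finally show ?thesis .
qed

lemma real_basis_orthonormal: "cinner (real_basis j) (real_basis k) = (if j = k then 1 else 0)"
proof -
  have "cinner (real_basis j) (real_basis k) = (\<Sum>b\<le>Suc k. cnj (Nmat \<alpha> k b) * Nmat \<alpha> j b)"
    unfolding real_basis_def[of k] by (simp add: cinner_simps cinner_real_basis_chi del: sum.atMost_Suc)
  also have "\<dots> = (Nmat \<alpha> \<odot> mat_dagger (Nmat \<alpha>)) j k"
    by (subst mat_mult_right_finite[of "Suc k"])
       (auto simp: mat_dagger_def Nmat_def diag12_band mult.commute simp del: sum.atMost_Suc)
  also have "\<dots> = mat_id j k" using Nmat_unitary[of \<alpha>, OF disk] by (simp add: unitary_matrix_def)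
  finally show ?thesis by (simp add: mat_id_def)
qed

text \<open>Expand \<open>real_basis k\<close> in \<open>chi_alt\<close> with coefficients from \<open>Nmat \<alpha>\<close>, apply \<open>U\<close>, which leads to
  \<open>chi\<close> through \<open>Lmat \<alpha>\<close>, and pair with \<open>real_basis j\<close>. Because the two expansions are conjugate,
  the last factor is a transpose and not an adjoint.\<close>

lemma real_basis_matrix: "cinner (real_basis j) (U (real_basis k)) = Smat \<alpha> j k"
proof -
  have "U (real_basis k) = (\<Sum>b\<le>Suc k. Nmat \<alpha> k b *\<^sub>C (\<Sum>a\<le>Suc b. Lmat \<alpha> a b *\<^sub>C chi a))"
    unfolding real_basis_alt by (simp only: clinear_sum[OF linear_U] clinear_scaleC[OF linear_U] U_chi_alt)
  then have "cinner (real_basis j) (U (real_basis k))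
      = (\<Sum>b\<le>Suc k. Nmat \<alpha> k b * (\<Sum>a\<le>Suc b. Lmat \<alpha> a b * Nmat \<alpha> j a))"
    by (simp only: cinner_simps cinner_real_basis_chi)
  also have "\<dots> = (\<Sum>b\<le>Suc k. Nmat \<alpha> k b * (\<Sum>a\<le>Suc j. Lmat \<alpha> a b * Nmat \<alpha> j a))"
  proof -
    have "(\<Sum>a\<le>Suc b. Lmat \<alpha> a b * Nmat \<alpha> j a) = (\<Sum>a\<le>Suc j. Lmat \<alpha> a b * Nmat \<alpha> j a)" for b
      by (intro sum.mono_neutral_cong) (auto simp: Lmat_def Nmat_def diag2_band diag12_band)
    then show ?thesis by (simp only:)
  qed
  also have "\<dots> = (\<Sum>b\<le>Suc k. \<Sum>a\<le>Suc j. Nmat \<alpha> j a * Lmat \<alpha> a b * Nmat \<alpha> k b)"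
    by (simp only: sum_distrib_left mult_ac)
  also have "\<dots> = Smat \<alpha> j k" unfolding Smat_eq_sum by (rule sum.swap)
  finally show ?thesis .
qed

end

context cmv_system begin

section \<open>The real basis as a Gram--Schmidt basis\<close>

lemma re_im_sequence_0 [simp]: "re_im_sequence U 0 = evec 0"
  by (simp add: re_im_sequence_def)

lemma re_im_sequence_odd:
  "re_im_sequence U (Suc (2 * m)) = (1 / (2 * \<i>)) *\<^sub>C (orbit (int (Suc m)) - orbit (- int (Suc m)))"
  by (simp add: re_im_sequence_def Im_op_orbit del: of_nat_Suc funpow.simps)

lemma re_im_sequence_even:
  "re_im_sequence U (Suc (Suc (2 * m))) = (1 / 2) *\<^sub>C (orbit (int (Suc m)) + orbit (- int (Suc m)))"
  by (simp add: re_im_sequence_def Re_op_orbit del: of_nat_Suc funpow.simps)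

lemma chi_leading:
  "chi (Suc (2 * m)) - kappa (Suc (2 * m)) *\<^sub>C orbit (int (Suc m)) \<in> laurent_span (- int m) (int m)"
  "chi_alt (Suc (2 * m)) - kappa (Suc (2 * m)) *\<^sub>C orbit (- int (Suc m)) \<in> laurent_span (- int m) (int m)"
proof -
  let ?k = "Suc (2 * m)"
  have "op_powi U (- int m) (phi ?k - kappa ?k *\<^sub>C orbit (int ?k)) \<in> laurent_span (- int m + 0) (- int m + (int ?k - 1))"
    using szego_leading[of ?k] by (intro op_powi_laurent_span) blast
  then show "chi ?k - kappa ?k *\<^sub>C orbit (int (Suc m)) \<in> laurent_span (- int m) (int m)"
    by (simp add: op_powi_simps op_powi_orbit chi_def add.commute)
  have "op_powi U (- int (Suc m)) (phis ?k - kappa ?k *\<^sub>C orbit 0)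
      \<in> laurent_span (- int (Suc m) + 1) (- int (Suc m) + int ?k)"
    using szego_leading[of ?k] by (intro op_powi_laurent_span) blast
  then show "chi_alt ?k - kappa ?k *\<^sub>C orbit (- int (Suc m)) \<in> laurent_span (- int m) (int m)"
    by (simp add: op_powi_simps op_powi_orbit chi_alt_def del: orbit_0)
qed

text \<open>Take \<open>\<chi>\<close>, \<open>\<kappa>\<close> and \<open>\<alpha>\<close> with index \<open>2 m + 1\<close>. Modulo lower exponents, \<open>2 Im \<chi>\<close> is
  \<open>2 \<kappa> Im (z\<^sup>m\<^sup>+\<^sup>1)\<close>, and \<open>2 Re ((1 - \<alpha>) \<chi>)\<close> is \<open>2 \<kappa> (1 - Re \<alpha>) Re (z\<^sup>m\<^sup>+\<^sup>1)\<close> plus a multiple of \<open>Im (z\<^sup>m\<^sup>+\<^sup>1)\<close>.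
  Both leading coefficients are positive, the second one because \<open>Re \<alpha> < 1\<close>; this fixes the signs of the Gram--Schmidt vectors.\<close>

lemma real_basis_leading:
  shows "\<exists>a::real. (0::real) < a \<and> re_im_sequence U (Suc (2 * m)) - complex_of_real a *\<^sub>C real_basis (Suc (2 * m))
      \<in> laurent_span (- int m) (int m)"
    and "\<exists>(a::real) b. (0::real) < a \<and> re_im_sequence U (Suc (Suc (2 * m)))
       - complex_of_real a *\<^sub>C real_basis (Suc (Suc (2 * m))) - b *\<^sub>C re_im_sequence U (Suc (2 * m))
      \<in> laurent_span (- int m) (int m)"
proof -
  define a where "a = \<alpha> (Suc (2 * m))"
  define o1 o2 where "o1 = orbit (int (Suc m))" and "o2 = orbit (- int (Suc m))"
  define \<kappa> where "\<kappa> = kappa (Suc (2 * m))"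
  define p q where "p = chi (Suc (2 * m)) - \<kappa> *\<^sub>C o1" and "q = chi_alt (Suc (2 * m)) - \<kappa> *\<^sub>C o2"
  have pq: "p \<in> laurent_span (- int m) (int m)" "q \<in> laurent_span (- int m) (int m)"
    unfolding p_def q_def o1_def o2_def \<kappa>_def by (rule chi_leading)+
  have chi: "chi (Suc (2 * m)) = \<kappa> *\<^sub>C o1 + p" "chi_alt (Suc (2 * m)) = \<kappa> *\<^sub>C o2 + q"
    by (simp_all add: p_def q_def)
  obtain c r :: real where cr: "c > 0" "r > 0"
    and s1: "real_basis (Suc (2 * m)) = c *\<^sub>C (- \<i> *\<^sub>C (chi (Suc (2 * m)) - chi_alt (Suc (2 * m))))"
    and s2: "real_basis (Suc (Suc (2 * m))) = complex_of_real (c / r) *\<^sub>C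
       ((1 - a) *\<^sub>C chi (Suc (2 * m)) + (1 - cnj a) *\<^sub>C chi_alt (Suc (2 * m)))"
    unfolding a_def by (rule real_basis_pair[of m]) blast
  have \<kappa>: "\<kappa> > 0" by (simp add: \<kappa>_def kappa_pos)
  define d where "d = 1 - Re a"
  have d: "d > 0"
    using complex_Re_le_cmod[of a] disk[of "Suc (2 * m)"] by (simp add: d_def a_def)
  have a: "1 - a = complex_of_real d - \<i> * Im a" "1 - cnj a = complex_of_real d + \<i> * Im a"
    by (simp_all add: d_def complex_eq_iff)
  note v = re_im_sequence_odd[of m, folded o1_def o2_def] re_im_sequence_even[of m, folded o1_def o2_def]
  \<comment> \<open>Here \<open>1 / (2 c \<kappa>)\<close> inverts the leading coefficient.\<close>
  have "re_im_sequence U (Suc (2 * m)) - complex_of_real (1 / (2 * c * \<kappa>)) *\<^sub>C real_basis (Suc (2 * m))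
      = (\<i> / (2 * \<kappa>)) *\<^sub>C (p - q)"
    unfolding v s1 chi using cr \<kappa> by (intro ell2_eqI) (simp add: field_simps)
  also have "\<dots> \<in> laurent_span (- int m) (int m)" by (intro laurent_span_closed pq)
  finally show "\<exists>a::real. (0::real) < a \<and> re_im_sequence U (Suc (2 * m)) - complex_of_real a *\<^sub>C real_basis (Suc (2 * m))
      \<in> laurent_span (- int m) (int m)"
    using cr \<kappa> by (intro exI[of _ "1 / (2 * c * \<kappa>)"]) simp
  \<comment> \<open>The first factor inverts the leading coefficient \<open>2 c \<kappa> d / r\<close>, and the second one removes the
    component along the preceding vector of the sequence.\<close>
  have "re_im_sequence U (Suc (Suc (2 * m)))
       - complex_of_real (r / (2 * c * \<kappa> * d)) *\<^sub>C real_basis (Suc (Suc (2 * m)))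
       - complex_of_real (- Im a / d) *\<^sub>C re_im_sequence U (Suc (2 * m))
      = (- 1 / (2 * \<kappa> * d)) *\<^sub>C ((1 - a) *\<^sub>C p + (1 - cnj a) *\<^sub>C q)"
    unfolding v s2 chi a using cr \<kappa> d by (intro ell2_eqI) (simp add: field_simps)
  also have "\<dots> \<in> laurent_span (- int m) (int m)" by (intro laurent_span_closed pq)
  finally show "\<exists>(a::real) b. (0::real) < a \<and> re_im_sequence U (Suc (Suc (2 * m)))
       - complex_of_real a *\<^sub>C real_basis (Suc (Suc (2 * m))) - b *\<^sub>C re_im_sequence U (Suc (2 * m))
      \<in> laurent_span (- int m) (int m)"
    using cr \<kappa> d by (intro exI[of _ "r / (2 * c * \<kappa> * d)"] exI[of _ "complex_of_real (- Im a / d)"]) simp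
qed

lemma cspan_closed:
  "x \<in> cspan B \<Longrightarrow> y \<in> cspan B \<Longrightarrow> x + y \<in> cspan B"
  "x \<in> cspan B \<Longrightarrow> y \<in> cspan B \<Longrightarrow> x - y \<in> cspan B"
  "x \<in> cspan B \<Longrightarrow> c *\<^sub>C x \<in> cspan B"
  "x \<in> B \<Longrightarrow> x \<in> cspan B"
  by (simp_all add: cspan_def ell2.span_add ell2.span_diff ell2.span_scale ell2.span_base)

lemma cspan_mono: "x \<in> cspan A \<Longrightarrow> A \<subseteq> B \<Longrightarrow> x \<in> cspan B"
  unfolding cspan_def using ell2.span_mono by blast

text \<open>By the leading terms, the two spans grow together, each pair of real vectors adding the exponents
  \<open>m + 1\<close> and \<open>- m - 1\<close>.\<close>

lemma laurent_span_real_basis: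
  "laurent_span (- int m) (int m) \<subseteq> cspan (real_basis ` {..<Suc (2 * m)})"
  and re_im_sequence_in_span:
  "re_im_sequence U (Suc (2 * m)) \<in> cspan (real_basis ` {..<Suc (Suc (2 * m))})"
proof -
  have step: "re_im_sequence U (Suc (2 * m)) \<in> cspan (real_basis ` {..<Suc (Suc (2 * m))})"
    if "laurent_span (- int m) (int m) \<subseteq> cspan (real_basis ` {..<Suc (2 * m)})" for m
  proof -
    obtain a :: real where "re_im_sequence U (Suc (2 * m)) - a *\<^sub>C real_basis (Suc (2 * m))
        \<in> laurent_span (- int m) (int m)"
      using real_basis_leading(1) by blast
    then have "re_im_sequence U (Suc (2 * m)) - a *\<^sub>C real_basis (Suc (2 * m))
        \<in> cspan (real_basis ` {..<Suc (Suc (2 * m))})"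
      by (rule cspan_mono[OF subsetD[OF that]]) auto
    moreover have "a *\<^sub>C real_basis (Suc (2 * m)) \<in> cspan (real_basis ` {..<Suc (Suc (2 * m))})"
      by (intro cspan_closed) auto
    ultimately show ?thesis using cspan_closed(1) by fastforce
  qed
  show sub: "laurent_span (- int m) (int m) \<subseteq> cspan (real_basis ` {..<Suc (2 * m)})" for m
  proof (induction m)
    case 0
    then show ?case by (simp add: laurent_span_def lessThan_Suc)
  next
    case (Suc m)
    let ?S = "cspan (real_basis ` {..<Suc (2 * Suc m)})"
    have old: "laurent_span (- int m) (int m) \<subseteq> ?S"
    proof
      fix x assume "x \<in> laurent_span (- int m) (int m)"
      then show "x \<in> ?S" by (rule cspan_mono[OF subsetD[OF Suc]]) auto
    qed
    have v1: "re_im_sequence U (Suc (2 * m)) \<in> ?S"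
      using step[OF Suc] by (auto elim: cspan_mono)
    obtain a :: real and b where "re_im_sequence U (Suc (Suc (2 * m)))
        - a *\<^sub>C real_basis (Suc (Suc (2 * m))) - b *\<^sub>C re_im_sequence U (Suc (2 * m))
        \<in> laurent_span (- int m) (int m)"
      using real_basis_leading(2) by blast
    with old have "(re_im_sequence U (Suc (Suc (2 * m)))
        - a *\<^sub>C real_basis (Suc (Suc (2 * m))) - b *\<^sub>C re_im_sequence U (Suc (2 * m)))
        + b *\<^sub>C re_im_sequence U (Suc (2 * m)) + a *\<^sub>C real_basis (Suc (Suc (2 * m))) \<in> ?S"
      by (intro cspan_closed(1) cspan_closed(3) v1) (auto intro: cspan_closed(4))
    then have v2: "re_im_sequence U (Suc (Suc (2 * m))) \<in> ?S" by simp
    have "orbit (int (Suc m)) = re_im_sequence U (Suc (Suc (2 * m))) + \<i> *\<^sub>C re_im_sequence U (Suc (2 * m))"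
      "orbit (- int (Suc m)) = re_im_sequence U (Suc (Suc (2 * m))) - \<i> *\<^sub>C re_im_sequence U (Suc (2 * m))"
      unfolding re_im_sequence_odd re_im_sequence_even
      by (intro ell2_eqI; simp add: field_simps)+
    then have new: "orbit (int (Suc m)) \<in> ?S" "orbit (- int (Suc m)) \<in> ?S"
      using cspan_closed(1,2)[OF v2 cspan_closed(3)[OF v1]] by simp_all
    have "orbit i \<in> ?S" if "i \<in> {- int (Suc m)..int (Suc m)}" for i
    proof -
      have "i = int (Suc m) \<or> i = - int (Suc m) \<or> i \<in> {- int m..int m}" using that by auto
      then show ?thesis using new old orbit_in_laurent_span[of "- int m" i "int m"] by auto
    qed
    then show ?case
      unfolding laurent_span_def cspan_def by (intro ell2.span_minimal) auto
  qed
  show "re_im_sequence U (Suc (2 * m)) \<in> cspan (real_basis ` {..<Suc (Suc (2 * m))})"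
    by (rule step[OF sub])
qed

lemma gs_basis_eq: "gs_basis U k = real_basis k"
  unfolding gs_basis_def
proof (rule gram_schmidt_unique[OF real_basis_orthonormal])
  fix k
  show "\<exists>a::real. (0::real) < a \<and>
      re_im_sequence U k - complex_of_real a *\<^sub>C real_basis k \<in> cspan (real_basis ` {..<k})"
  proof (cases k rule: nat_cases_odd_even)
    case 1
    then show ?thesis by (intro exI[of _ 1]) (simp add: cspan_def ell2.span_zero)
  next
    case (2 m)
    then show ?thesis using real_basis_leading(1)[of m] laurent_span_real_basis[of m] by blast
  next
    case (3 m)
    obtain a :: real and b where a: "(0::real) < a" and "re_im_sequence U k
        - a *\<^sub>C real_basis k - b *\<^sub>C re_im_sequence U (Suc (2 * m))
        \<in> laurent_span (- int m) (int m)"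
      using real_basis_leading(2) 3 by blast
    then have "re_im_sequence U k - a *\<^sub>C real_basis k - b *\<^sub>C re_im_sequence U (Suc (2 * m))
        \<in> cspan (real_basis ` {..<k})"
      using laurent_span_real_basis[of m] 3 by (auto elim!: cspan_mono[OF subsetD])
    then have "re_im_sequence U k - a *\<^sub>C real_basis k - b *\<^sub>C re_im_sequence U (Suc (2 * m))
        + b *\<^sub>C re_im_sequence U (Suc (2 * m)) \<in> cspan (real_basis ` {..<k})"
      unfolding 3 by (intro cspan_closed(1) cspan_closed(3) re_im_sequence_in_span)
    with a show ?thesis by auto
  qed
qed

lemma gs_basis_orthonormal_basis:
  assumes "cyclic_vector U (evec 0)"
  shows "orthonormal_basis (gs_basis U)"
proof -
  have "orbit i \<in> cspan (range real_basis)" for i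
  proof -
    have "orbit i \<in> laurent_span (- int (nat \<bar>i\<bar>)) (int (nat \<bar>i\<bar>))"
      by (rule orbit_in_laurent_span) auto
    then show ?thesis by (rule cspan_mono[OF subsetD[OF laurent_span_real_basis]]) auto
  qed
  then have "cspan (range orbit) \<subseteq> cspan (range real_basis)"
    unfolding cspan_def by (intro ell2.span_minimal) auto
  moreover have "closure (cspan (range orbit)) = UNIV"
    using assms by (simp add: cyclic_vector_def orbit_def[abs_def])
  ultimately have "closure (cspan (range real_basis)) = UNIV"
    using closure_mono by blast
  then show ?thesis
    by (simp add: orthonormal_basis_def gs_basis_eq[abs_def] real_basis_orthonormal)
qed

end

section \<open>The change of basis\<close>

text \<open>The coefficient map of the basis is an isometry \<open>T\<close>, and its adjoint is the synthesis map \<open>R\<close>.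
  Density of the span yields that \<open>R \<circ> T\<close> is the identity.\<close>

lemma orthonormal_basis_isomorphism:
  assumes "orthonormal_basis s"
  obtains R where "bounded_clinear R" "bounded_clinear (adj R)"
    "\<And>x y. cinner (R x) y = cinner x (adj R y)"
    "\<And>k. R (evec k) = s k" "\<And>x. adj R (R x) = x" "\<And>x. R (adj R x) = x"
proof -
  have orth: "cinner (s j) (s k) = (if j = k then 1 else 0)" for j k
    using assms by (auto simp: orthonormal_basis_def)
  have dense: "closure (cspan (range s)) = UNIV"
    using assms by (simp add: orthonormal_basis_def)
  have "norm (\<Sum>k<n. c k *\<^sub>C s k) = norm (\<Sum>k<n. c k *\<^sub>C evec k)" for c and n :: nat
  proof -
    have "(norm (\<Sum>k<n. c k *\<^sub>C s k))\<^sup>2 = (norm (\<Sum>k<n. c k *\<^sub>C evec k))\<^sup>2"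
      using norm_sum_orthonormal[OF orth, of c n] norm_sum_orthonormal[of evec c n] by simp
    then show ?thesis by (rule power2_eq_imp_eq) simp_all
  qed
  then obtain T where T: "bounded_clinear T" and contr: "\<And>x. norm (T x) \<le> norm x"
    and coord_T: "\<And>x k. coord (T x) k = cinner (s k) x"
    using coefficient_operator[of s] by (metis order_refl)
  define R where "R = adj T"
  have R: "bounded_clinear R" and TR: "cinner (T x) y = cinner x (R y)" for x y
    unfolding R_def by (rule contraction_adjoint[OF T contr])+
  have RT: "cinner (R x) y = cinner x (T y)" for x y
    using TR[of y x] by (metis cinner_commute)
  then have adjR: "adj R = T" by (rule adj_eqI)
  have Re: "R (evec k) = s k" for k
    by (rule ell2_eqI_cinner) (simp add: RT coord_T)
  have TRx: "T (R x) = x" for x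
  proof (rule ell2_eqI)
    fix k
    have "coord (T (R x)) k = cinner (T (s k)) x" by (simp add: coord_T TR)
    also have "T (s k) = evec k" by (rule ell2_eqI) (simp add: coord_T orth)
    finally show "coord (T (R x)) k = coord x k" by simp
  qed
  have lin: "Vector_Spaces.linear scaleC scaleC R" "Vector_Spaces.linear scaleC scaleC T"
    using R T by (simp_all add: bounded_clinear_def)
  have RTx: "R (T x) = x" for x
  proof (rule dense_span_induct[OF dense, of "\<lambda>x. R (T x) = x"])
    show "closed {x. R (T x) = x}"
      by (intro closed_Collect_eq continuous_intros
          continuous_on_compose2[OF bounded_clinear_continuous[OF R] bounded_clinear_continuous[OF T]]) auto
    show "R (T x) = x" if "x \<in> range s" for x
      using that by (auto simp: TRx simp flip: Re)
  qed (simp_all add: clinear_add[OF lin(1)] clinear_add[OF lin(2)] clinear_scaleC[OF lin(1)]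
      clinear_scaleC[OF lin(2)] clinear_zero[OF lin(1)] clinear_zero[OF lin(2)])
  show thesis
    by (rule that[of R]) (simp_all add: adjR R T RT Re TRx RTx)
qed

section \<open>Reality in the symmetric case\<close>

lift_definition conj_ell2 :: "ell2 \<Rightarrow> ell2" is "\<lambda>x n. cnj (x n)"
  by simp

lemma coord_conj [simp]: "coord (conj_ell2 x) n = cnj (coord x n)"
  by transfer simp

lemma conj_simps:
  "conj_ell2 (x + y) = conj_ell2 x + conj_ell2 y" "conj_ell2 (x - y) = conj_ell2 x - conj_ell2 y"
  "conj_ell2 (c *\<^sub>C x) = cnj c *\<^sub>C conj_ell2 x" "conj_ell2 (evec k) = evec k"
  "conj_ell2 (\<Sum>i\<in>F. f i) = (\<Sum>i\<in>F. conj_ell2 (f i))"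
  by (rule ell2_eqI; simp)+

lemma cinner_conj: "cinner (conj_ell2 x) (conj_ell2 y) = cnj (cinner x y)"
  unfolding cinner_def
  by (subst bounded_linear.suminf[OF bounded_linear_cnj summable_cinner]) simp

lemma gram_schmidt_conj:
  assumes "\<And>k. conj_ell2 (v k) = v k"
  shows "conj_ell2 (gram_schmidt v k) = gram_schmidt v k"
proof (induction k rule: less_induct)
  case (less k)
  have "cnj (cinner (gram_schmidt v j) (v k)) = cinner (gram_schmidt v j) (v k)" if "j < k" for j
    by (subst cinner_conj[symmetric]) (simp add: assms less that)
  then have "conj_ell2 (v k - (\<Sum>j<k. cinner (gram_schmidt v j) (v k) *\<^sub>C gram_schmidt v j))
      = v k - (\<Sum>j<k. cinner (gram_schmidt v j) (v k) *\<^sub>C gram_schmidt v j)"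
    by (simp add: conj_simps assms less)
  then show ?case
    by (subst (1 2) gram_schmidt.simps) (simp add: Let_def scaleR_eq_scaleC conj_simps)
qed

text \<open>Symmetry of the matrix means that conjugating \<open>U\<close> by the complex conjugation of coordinates gives
  \<open>inv U\<close>. The conjugation therefore reverses the orbit of the real vector \<open>evec 0\<close>, and fixes the
  combinations \<open>Re (U\<^sup>k) e\<close> and \<open>Im (U\<^sup>k) e\<close>.\<close>

lemma (in unitary_operator) re_im_sequence_conj:
  assumes "mat_transpose (op_matrix U) = op_matrix U"
  shows "conj_ell2 (re_im_sequence U n) = re_im_sequence U n"
proof -
  have sym: "coord (U (evec k)) j = coord (U (evec j)) k" for j k
    using fun_cong[OF fun_cong[OF assms, of k], of j] by (simp add: mat_transpose_def op_matrix_def)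
  have "conj_ell2 (U (evec j)) = inv U (evec j)" for j
  proof (rule ell2_eqI)
    fix k
    have "coord (inv U (evec j)) k = cinner (U (evec k)) (evec j)"
      by (simp only: cinner_U_left cinner_evec(1))
    then show "coord (conj_ell2 (U (evec j))) k = coord (inv U (evec j)) k"
      by (simp add: sym)
  qed
  then have conj_U: "conj_ell2 (U x) = inv U (conj_ell2 x)" for x
  proof (intro ell2_eqI)
    fix j
    have "coord (inv U (conj_ell2 x)) j = cinner (U (evec j)) (conj_ell2 x)"
      by (simp only: cinner_U_left cinner_evec(1))
    also have "\<dots> = cnj (cinner (conj_ell2 (U (evec j))) x)"
      by (subst cinner_conj[symmetric]) (rule arg_cong2[of _ _ _ _ cinner]; rule ell2_eqI; simp)
    also have "\<dots> = cnj (coord (U x) j)"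
      using cinner_U[of "inv U (evec j)" x]
      by (simp add: \<open>\<And>j. conj_ell2 (U (evec j)) = inv U (evec j)\<close>)
    finally show "coord (conj_ell2 (U x)) j = coord (inv U (conj_ell2 x)) j" by simp
  qed
  have conj_orbit: "conj_ell2 (orbit m) = orbit (- m)" for m
  proof (induction m rule: int_induct[where k = 0])
    case (step1 i)
    have "orbit (- i) = U (orbit (- (i + 1)))" by (simp add: U_orbit)
    then have "inv U (orbit (- i)) = orbit (- (i + 1))" by simp
    with step1 show ?case by (simp only: U_orbit[symmetric] conj_U)
  next
    case (step2 i)
    have "inv U (conj_ell2 (orbit (i - 1))) = orbit (- i)"
      using step2 U_orbit[of "i - 1"] conj_U[of "orbit (i - 1)"] by simp
    then have "conj_ell2 (orbit (i - 1)) = U (orbit (- i))" by (metis U_inv(1))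
    then show ?case by (simp add: U_orbit)
  qed (simp add: conj_simps)
  have "conj_ell2 (Re_op (U ^^ k) (evec 0)) = Re_op (U ^^ k) (evec 0)"
    "conj_ell2 (Im_op (U ^^ k) (evec 0)) = Im_op (U ^^ k) (evec 0)" for k
    unfolding Re_op_orbit Im_op_orbit conj_simps conj_orbit
    by (intro ell2_eqI; simp add: field_simps)+
  then show ?thesis by (simp add: re_im_sequence_def conj_simps del: funpow.simps)
qed

section \<open>The symmetric seven-diagonal form\<close>

theorem proposition9p1:
  fixes U :: "ell2 \<Rightarrow> ell2" and \<mu> :: "complex measure" and \<alpha> :: "nat \<Rightarrow> complex"
  assumes "unitary_op U"
    and "cyclic_vector U (evec 0)"
    and "spectral_measure U (evec 0) \<mu>"
    and "verblunsky_coeffs \<mu> \<alpha>"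
    and "\<forall>k. \<alpha> k \<in> ball 0 1"
  shows "orthonormal_basis (gs_basis U) \<and>
    (\<forall>j k. cinner (gs_basis U j) (U (gs_basis U k)) = Smat \<alpha> j k) \<and>
    mat_transpose (Lmat \<alpha>) = Lmat \<alpha> \<and>
    unitary_matrix (Nmat \<alpha>) \<and>
    (\<forall>j k. \<bar>int j - int k\<bar> > 3 \<longrightarrow> Smat \<alpha> j k = 0) \<and>
    mat_transpose (Smat \<alpha>) = Smat \<alpha> \<and>
    (\<exists>R S.
       bounded_clinear R \<and> op_matrix R = (\<lambda>j k. coord (gs_basis U k) j) \<and>
       bounded_clinear S \<and> op_matrix S = Smat \<alpha> \<and>
       U = R \<circ> S \<circ> adj R \<and>
       adj R \<circ> R = id \<and> R \<circ> adj R = id \<and>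
       R (evec 0) = evec 0 \<and> adj R (evec 0) = evec 0 \<and>
       (mat_transpose (op_matrix U) = op_matrix U \<longrightarrow> orthogonal_op R))"
proof -
  interpret unitary_operator U by unfold_locales fact
  have disk: "cmod (\<alpha> k) < 1" for k using assms(5) by simp
  interpret cmv_system U \<alpha>
    using szego_orthogonal[OF assms(3,4)] disk by unfold_locales auto
  have basis: "orthonormal_basis (gs_basis U)" by (rule gs_basis_orthonormal_basis[OF assms(2)])
  have matrix: "cinner (gs_basis U j) (U (gs_basis U k)) = Smat \<alpha> j k" for j k
    by (simp only: gs_basis_eq real_basis_matrix)
  obtain R where R: "bounded_clinear R" "bounded_clinear (adj R)"
    and adj: "\<And>x y. cinner (R x) y = cinner x (adj R y)"
    and R_evec: "\<And>k. R (evec k) = gs_basis U k"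
    and inv: "\<And>x. adj R (R x) = x" "\<And>x. R (adj R x) = x"
    using orthonormal_basis_isomorphism[OF basis] by blast
  have U_bounded: "bounded_clinear U"
  proof (rule bounded_clinearI)
    show "norm (U x) \<le> norm x" for x
      by (simp add: norm_ell2_def inner_ell2_def cinner_U)
  qed (simp_all add: clinear_add[OF linear_U] clinear_scaleC[OF linear_U])
  define S where "S = adj R \<circ> U \<circ> R"
  have S: "bounded_clinear S"
    unfolding S_def by (intro bounded_clinear_compose R U_bounded)
  have R_matrix: "op_matrix R = (\<lambda>j k. coord (gs_basis U k) j)"
    by (simp add: op_matrix_def R_evec fun_eq_iff)
  have S_matrix: "op_matrix S = Smat \<alpha>"
    by (simp only: op_matrix_def S_def comp_apply adj[symmetric] R_evec matrix)
  have U: "U = R \<circ> S \<circ> adj R" by (simp add: fun_eq_iff S_def inv)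
  have R0: "R (evec 0) = evec 0" by (simp add: R_evec gs_basis_eq)
  then have adjR0: "adj R (evec 0) = evec 0" using inv(1)[of "evec 0"] by simp
  have orthogonal: "orthogonal_op R" if "mat_transpose (op_matrix U) = op_matrix U"
  proof -
    have "unitary_op R"
      unfolding unitary_op_def surj_def using R by (auto simp: bounded_clinear_def adj inv) (metis inv(2))
    moreover have "op_matrix R j k \<in> \<real>" for j k
    proof -
      have "conj_ell2 (gs_basis U k) = gs_basis U k"
        unfolding gs_basis_def by (intro gram_schmidt_conj re_im_sequence_conj that)
      then have "cnj (coord (gs_basis U k) j) = coord (gs_basis U k) j"
        by (metis coord_conj)
      then show ?thesis by (simp add: R_matrix Reals_cnj_iff)
    qed
    ultimately show ?thesis by (simp add: orthogonal_op_def)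
  qed
  have inv': "adj R \<circ> R = id" "R \<circ> adj R = id" by (simp_all add: fun_eq_iff inv)
  have N: "unitary_matrix (Nmat \<alpha>)" by (rule Nmat_unitary) (rule disk)
  show ?thesis
    by (intro conjI allI impI exI[of _ R] exI[of _ S] basis matrix Lmat_transpose N Smat_transpose
        R(1) R_matrix S S_matrix U inv' R0 adjR0 orthogonal) (rule Smat_band)
qed

end
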